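(* Let $\mathcal{T}=(T,m,e)$ be a monad and $\mathcal{G}=(G,\delta,\varepsilon)$ a comonad on a category $\mathbb{A}$, let $\lambda:TG\to GT$ be an entwining from $\mathcal{T}$ to $\mathcal{G}$, and let $g:1\to G$ be a grouplike morphism of the comonad $\mathcal{G}$. Let $\widehat{\mathcal{G}}$ be the comonad on the category $\mathbb{A}_{\mathcal{T}}$ of $\mathcal{T}$-modules lifting $\mathcal{G}$ via $\lambda$. Then the induced functor $$K_g:\mathbb{A}\to(\mathbb{A}_{\mathcal{T}})^{\widehat{\mathcal{G}}},\qquad a\mapsto\big((T(a),m_a),\ \lambda_a\cdot T(g_a)\big)$$ is an equivalence of categories if and only if both of the following hold: (i) the free functor $\phi_{\mathcal{T}}:\mathbb{A}\to\mathbb{A}_{\mathcal{T}}$, $a\mapsto(T(a),m_a)$, is comonadic; (ii) for every $(a,h)\in\mathbb{A}_{\mathcal{T}}$ the composite $$T(a)\xrightarrow{T(g_a)}TG(a)\xrightarrow{\lambda_a}GT(a)\xrightarrow{G(h)}G(a)$$ is an isomorphism.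
   Context: Composition of functors is written by juxtaposition and composition of morphisms and natural transformations by $\cdot$. $\mathbb{A}_{\mathcal{T}}$ is the Eilenberg–Moore category of $\mathcal{T}$-modules (pairs $(a,h:T(a)\to a)$, also called $\mathcal{T}$-algebras); for a comonad $\mathcal{G}$, a $\mathcal{G}$-comodule is an Eilenberg–Moore coalgebra, and the category of these is denoted by a superscript. An entwining (mixed distributive law) from $\mathcal{T}$ to $\mathcal{G}$ is a natural transformation $\lambda:TG\to GT$ with $$\lambda\cdot mG=Gm\cdot\lambda T\cdot T\lambda,\quad \delta T\cdot\lambda=G\lambda\cdot\lambda G\cdot T\delta,\quad \lambda\cdot eG=Ge,\quad \varepsilon T\cdot\lambda=T\varepsilon.$$ The lifted comonad $\widehat{\mathcal{G}}=(\widehat G,\widehat\delta,\widehat\varepsilon)$ on $\mathbb{A}_{\mathcal{T}}$ is given by $\widehat G(a,h)=(G(a),G(h)\cdot\lambda_a)$, $\widehat\delta_{(a,h)}=\delta_a$, $\widehat\varepsilon_{(a,h)}=\varepsilon_a$. A grouplike morphism of $\mathcal{G}$ is a natural transformation $g:1\to G$ that is a comonad morphism from the identity comonad to $\mathcal{G}$, i.e. $\varepsilon\cdot g=1$ and $\delta\cdot g=gg$ (with $gg=Gg\cdot g=gG\cdot g$). On morphisms, $K_g(f)=T(f)$. A functor $F$ with a right adjoint $R$ is comonadic if the canonical comparison functor from its domain to the category of comodules over the comonad $FR$ generated by the adjunction is an equivalence; here $\phi_{\mathcal{T}}$ has as right adjoint the forgetful functor $\mathbb{A}_{\mathcal{T}}\to\mathbb{A}$.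 *)

theory Defs
  imports Main
begin

section \<open>Categories, functors, natural transformations\<close>

text \<open>
  Objects and arrows form explicit carrier sets, and an arrow determines its domain and
  codomain. Composition and the other operations are constrained only on the carriers.
\<close>

record ('o, 'a) cat =
  Obj :: "'o set"
  Arr :: "'a set"
  Dom :: "'a \<Rightarrow> 'o"
  Cod :: "'a \<Rightarrow> 'o"
  Ident :: "'o \<Rightarrow> 'a"
  Comp :: "'a \<Rightarrow> 'a \<Rightarrow> 'a" (infixr "\<cdot>\<index>" 70)

definition Hom :: "('o, 'a) cat \<Rightarrow> 'o \<Rightarrow> 'o \<Rightarrow> 'a set" where
  "Hom C x y = {f \<in> Arr C. Dom C f = x \<and> Cod C f = y}"

locale category =
  fixes C :: "('o, 'a) cat" (structure)
  assumes dom_obj: "f \<in> Arr C \<Longrightarrow> Dom C f \<in> Obj C"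
    and cod_obj: "f \<in> Arr C \<Longrightarrow> Cod C f \<in> Obj C"
    and ident_hom: "x \<in> Obj C \<Longrightarrow> Ident C x \<in> Hom C x x"
    and comp_hom: "\<lbrakk>f \<in> Hom C x y; g \<in> Hom C y z\<rbrakk> \<Longrightarrow> g \<cdot> f \<in> Hom C x z"
    and ident_left: "f \<in> Hom C x y \<Longrightarrow> Ident C y \<cdot> f = f"
    and ident_right: "f \<in> Hom C x y \<Longrightarrow> f \<cdot> Ident C x = f"
    and comp_assoc:
      "\<lbrakk>f \<in> Hom C w x; g \<in> Hom C x y; h \<in> Hom C y z\<rbrakk> \<Longrightarrow> (h \<cdot> g) \<cdot> f = h \<cdot> (g \<cdot> f)"

definition is_iso :: "('o, 'a) cat \<Rightarrow> 'a \<Rightarrow> bool" where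
  "is_iso C f \<longleftrightarrow> f \<in> Arr C \<and>
     (\<exists>g \<in> Hom C (Cod C f) (Dom C f).
        g \<cdot>\<^bsub>C\<^esub> f = Ident C (Dom C f) \<and> f \<cdot>\<^bsub>C\<^esub> g = Ident C (Cod C f))"

record ('o, 'a, 'p, 'b) functor_data =
  ob :: "'o \<Rightarrow> 'p"
  ar :: "'a \<Rightarrow> 'b"

definition id_fun :: "('o, 'a, 'o, 'a) functor_data" where
  "id_fun = \<lparr>ob = (\<lambda>x. x), ar = (\<lambda>f. f)\<rparr>"

definition comp_fun ::
  "('p, 'b, 'q, 'c) functor_data \<Rightarrow> ('o, 'a, 'p, 'b) functor_data \<Rightarrow> ('o, 'a, 'q, 'c) functor_data"
  (infixr "\<circ>\<^sub>F" 75) where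
  "F \<circ>\<^sub>F H = \<lparr>ob = (\<lambda>x. ob F (ob H x)), ar = (\<lambda>f. ar F (ar H f))\<rparr>"

definition is_functor ::
  "('o, 'a) cat \<Rightarrow> ('p, 'b) cat \<Rightarrow> ('o, 'a, 'p, 'b) functor_data \<Rightarrow> bool" where
  "is_functor C D F \<longleftrightarrow>
     (\<forall>x \<in> Obj C. ob F x \<in> Obj D) \<and>
     (\<forall>x \<in> Obj C. \<forall>y \<in> Obj C. \<forall>f \<in> Hom C x y. ar F f \<in> Hom D (ob F x) (ob F y)) \<and>
     (\<forall>x \<in> Obj C. ar F (Ident C x) = Ident D (ob F x)) \<and>
     (\<forall>f \<in> Arr C. \<forall>g \<in> Arr C. Dom C g = Cod C f \<longrightarrow> ar F (g \<cdot>\<^bsub>C\<^esub> f) = ar F g \<cdot>\<^bsub>D\<^esub> ar F f)"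

definition is_nat_trans ::
  "('o, 'a) cat \<Rightarrow> ('p, 'b) cat \<Rightarrow> ('o, 'a, 'p, 'b) functor_data \<Rightarrow> ('o, 'a, 'p, 'b) functor_data
    \<Rightarrow> ('o \<Rightarrow> 'b) \<Rightarrow> bool" where
  "is_nat_trans C D F H \<tau> \<longleftrightarrow>
     (\<forall>x \<in> Obj C. \<tau> x \<in> Hom D (ob F x) (ob H x)) \<and>
     (\<forall>f \<in> Arr C. \<tau> (Cod C f) \<cdot>\<^bsub>D\<^esub> ar F f = ar H f \<cdot>\<^bsub>D\<^esub> \<tau> (Dom C f))"

definition naturally_isomorphic ::
  "('o, 'a) cat \<Rightarrow> ('p, 'b) cat \<Rightarrow> ('o, 'a, 'p, 'b) functor_data \<Rightarrow> ('o, 'a, 'p, 'b) functor_data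
    \<Rightarrow> bool" where
  "naturally_isomorphic C D F H \<longleftrightarrow>
     (\<exists>\<tau>. is_nat_trans C D F H \<tau> \<and> (\<forall>x \<in> Obj C. is_iso D (\<tau> x)))"

definition is_equivalence ::
  "('o, 'a) cat \<Rightarrow> ('p, 'b) cat \<Rightarrow> ('o, 'a, 'p, 'b) functor_data \<Rightarrow> bool" where
  "is_equivalence C D F \<longleftrightarrow> is_functor C D F \<and>
     (\<exists>Q. is_functor D C Q \<and>
        naturally_isomorphic C C (Q \<circ>\<^sub>F F) id_fun \<and>
        naturally_isomorphic D D (F \<circ>\<^sub>F Q) id_fun)"


section \<open>Monads, comonads and their Eilenberg--Moore categories\<close>

text \<open>Equations between natural transformations are written out at each object.\<close>

locale monad = category C for C :: "('o, 'a) cat" (structure) +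
  fixes T :: "('o, 'a, 'o, 'a) functor_data" and m :: "'o \<Rightarrow> 'a" and e :: "'o \<Rightarrow> 'a"
  assumes monad_functor: "is_functor C C T"
    and mult_nat: "is_nat_trans C C (T \<circ>\<^sub>F T) T m"
    and unit_nat: "is_nat_trans C C id_fun T e"
    and mult_assoc: "x \<in> Obj C \<Longrightarrow> m x \<cdot> ar T (m x) = m x \<cdot> m (ob T x)"
    and unit_left: "x \<in> Obj C \<Longrightarrow> m x \<cdot> e (ob T x) = Ident C (ob T x)"
    and unit_right: "x \<in> Obj C \<Longrightarrow> m x \<cdot> ar T (e x) = Ident C (ob T x)"

locale comonad = category C for C :: "('o, 'a) cat" (structure) +
  fixes G :: "('o, 'a, 'o, 'a) functor_data" and \<delta> :: "'o \<Rightarrow> 'a" and \<epsilon> :: "'o \<Rightarrow> 'a"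
  assumes comonad_functor: "is_functor C C G"
    and comult_nat: "is_nat_trans C C G (G \<circ>\<^sub>F G) \<delta>"
    and counit_nat: "is_nat_trans C C G id_fun \<epsilon>"
    and comult_coassoc: "x \<in> Obj C \<Longrightarrow> ar G (\<delta> x) \<cdot> \<delta> x = \<delta> (ob G x) \<cdot> \<delta> x"
    and counit_left: "x \<in> Obj C \<Longrightarrow> \<epsilon> (ob G x) \<cdot> \<delta> x = Ident C (ob G x)"
    and counit_right: "x \<in> Obj C \<Longrightarrow> ar G (\<epsilon> x) \<cdot> \<delta> x = Ident C (ob G x)"

text \<open>
  A (co)module is a pair of an object and a structure arrow. A morphism of (co)modules is the
  triple of its domain, the underlying arrow and its codomain, because one underlying arrow
  may be a morphism between several different pairs of (co)modules.
\<close>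

type_synonym ('o, 'a) module_obj = "'o \<times> 'a"
type_synonym ('o, 'a) module_arr = "('o, 'a) module_obj \<times> 'a \<times> ('o, 'a) module_obj"

definition is_module ::
  "('o, 'a) cat \<Rightarrow> ('o, 'a, 'o, 'a) functor_data \<Rightarrow> ('o \<Rightarrow> 'a) \<Rightarrow> ('o \<Rightarrow> 'a)
    \<Rightarrow> ('o, 'a) module_obj \<Rightarrow> bool" where
  "is_module C T m e = (\<lambda>(a, h). a \<in> Obj C \<and> h \<in> Hom C (ob T a) a \<and>
     h \<cdot>\<^bsub>C\<^esub> e a = Ident C a \<and> h \<cdot>\<^bsub>C\<^esub> m a = h \<cdot>\<^bsub>C\<^esub> ar T h)"

definition module_hom ::
  "('o, 'a) cat \<Rightarrow> ('o, 'a, 'o, 'a) functor_data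
    \<Rightarrow> ('o, 'a) module_obj \<Rightarrow> ('o, 'a) module_obj \<Rightarrow> 'a set" where
  "module_hom C T = (\<lambda>(a, h) (b, k). {f \<in> Hom C a b. f \<cdot>\<^bsub>C\<^esub> h = k \<cdot>\<^bsub>C\<^esub> ar T f})"

definition module_cat ::
  "('o, 'a) cat \<Rightarrow> ('o, 'a, 'o, 'a) functor_data \<Rightarrow> ('o \<Rightarrow> 'a) \<Rightarrow> ('o \<Rightarrow> 'a)
    \<Rightarrow> (('o, 'a) module_obj, ('o, 'a) module_arr) cat" where
  "module_cat C T m e =
     \<lparr>Obj = {X. is_module C T m e X},
      Arr = {(X, f, Y). is_module C T m e X \<and> is_module C T m e Y \<and> f \<in> module_hom C T X Y},
      Dom = (\<lambda>(X, f, Y). X),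
      Cod = (\<lambda>(X, f, Y). Y),
      Ident = (\<lambda>X. (X, Ident C (fst X), X)),
      Comp = (\<lambda>(Y', g, Z) (X, f, Y). (X, g \<cdot>\<^bsub>C\<^esub> f, Z))\<rparr>"

definition is_comodule ::
  "('o, 'a) cat \<Rightarrow> ('o, 'a, 'o, 'a) functor_data \<Rightarrow> ('o \<Rightarrow> 'a) \<Rightarrow> ('o \<Rightarrow> 'a)
    \<Rightarrow> ('o, 'a) module_obj \<Rightarrow> bool" where
  "is_comodule C G \<delta> \<epsilon> = (\<lambda>(a, \<theta>). a \<in> Obj C \<and> \<theta> \<in> Hom C a (ob G a) \<and>
     \<epsilon> a \<cdot>\<^bsub>C\<^esub> \<theta> = Ident C a \<and> \<delta> a \<cdot>\<^bsub>C\<^esub> \<theta> = ar G \<theta> \<cdot>\<^bsub>C\<^esub> \<theta>)"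

definition comodule_hom ::
  "('o, 'a) cat \<Rightarrow> ('o, 'a, 'o, 'a) functor_data
    \<Rightarrow> ('o, 'a) module_obj \<Rightarrow> ('o, 'a) module_obj \<Rightarrow> 'a set" where
  "comodule_hom C G = (\<lambda>(a, \<theta>) (b, \<kappa>). {f \<in> Hom C a b. \<kappa> \<cdot>\<^bsub>C\<^esub> f = ar G f \<cdot>\<^bsub>C\<^esub> \<theta>})"

definition comodule_cat ::
  "('o, 'a) cat \<Rightarrow> ('o, 'a, 'o, 'a) functor_data \<Rightarrow> ('o \<Rightarrow> 'a) \<Rightarrow> ('o \<Rightarrow> 'a)
    \<Rightarrow> (('o, 'a) module_obj, ('o, 'a) module_arr) cat" where
  "comodule_cat C G \<delta> \<epsilon> =
     \<lparr>Obj = {X. is_comodule C G \<delta> \<epsilon> X},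
      Arr = {(X, f, Y). is_comodule C G \<delta> \<epsilon> X \<and> is_comodule C G \<delta> \<epsilon> Y \<and> f \<in> comodule_hom C G X Y},
      Dom = (\<lambda>(X, f, Y). X),
      Cod = (\<lambda>(X, f, Y). Y),
      Ident = (\<lambda>X. (X, Ident C (fst X), X)),
      Comp = (\<lambda>(Y', g, Z) (X, f, Y). (X, g \<cdot>\<^bsub>C\<^esub> f, Z))\<rparr>"


section \<open>Adjunctions and comonadic functors\<close>

definition is_adjunction ::
  "('o, 'a) cat \<Rightarrow> ('p, 'b) cat \<Rightarrow> ('o, 'a, 'p, 'b) functor_data \<Rightarrow> ('p, 'b, 'o, 'a) functor_data
    \<Rightarrow> ('o \<Rightarrow> 'a) \<Rightarrow> ('p \<Rightarrow> 'b) \<Rightarrow> bool" where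
  "is_adjunction C D F R \<eta> \<sigma> \<longleftrightarrow>
     is_functor C D F \<and> is_functor D C R \<and>
     is_nat_trans C C id_fun (R \<circ>\<^sub>F F) \<eta> \<and> is_nat_trans D D (F \<circ>\<^sub>F R) id_fun \<sigma> \<and>
     (\<forall>c \<in> Obj C. \<sigma> (ob F c) \<cdot>\<^bsub>D\<^esub> ar F (\<eta> c) = Ident D (ob F c)) \<and>
     (\<forall>d \<in> Obj D. ar R (\<sigma> d) \<cdot>\<^bsub>C\<^esub> \<eta> (ob R d) = Ident C (ob R d))"

text \<open>
  The adjunction generates the comonad \<open>(F R, F \<eta> R, \<sigma>)\<close> on \<open>D\<close>; the comparison functor
  sends \<open>c\<close> to \<open>(F c, F \<eta>\<^sub>c)\<close>.
\<close>

definition adj_comodule_cat ::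
  "('p, 'b) cat \<Rightarrow> ('o, 'a, 'p, 'b) functor_data \<Rightarrow> ('p, 'b, 'o, 'a) functor_data
    \<Rightarrow> ('o \<Rightarrow> 'a) \<Rightarrow> ('p \<Rightarrow> 'b) \<Rightarrow> (('p, 'b) module_obj, ('p, 'b) module_arr) cat" where
  "adj_comodule_cat D F R \<eta> \<sigma> = comodule_cat D (F \<circ>\<^sub>F R) (\<lambda>d. ar F (\<eta> (ob R d))) \<sigma>"

definition comparison ::
  "('o, 'a) cat \<Rightarrow> ('o, 'a, 'p, 'b) functor_data \<Rightarrow> ('o \<Rightarrow> 'a)
    \<Rightarrow> ('o, 'a, ('p, 'b) module_obj, ('p, 'b) module_arr) functor_data" where
  "comparison C F \<eta> =
     (let K = (\<lambda>c. (ob F c, ar F (\<eta> c)))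
      in \<lparr>ob = K, ar = (\<lambda>f. (K (Dom C f), ar F f, K (Cod C f)))\<rparr>)"

definition is_comonadic ::
  "('o, 'a) cat \<Rightarrow> ('p, 'b) cat \<Rightarrow> ('o, 'a, 'p, 'b) functor_data \<Rightarrow> ('p, 'b, 'o, 'a) functor_data
    \<Rightarrow> ('o \<Rightarrow> 'a) \<Rightarrow> ('p \<Rightarrow> 'b) \<Rightarrow> bool" where
  "is_comonadic C D F R \<eta> \<sigma> \<longleftrightarrow> is_adjunction C D F R \<eta> \<sigma> \<and>
     is_equivalence C (adj_comodule_cat D F R \<eta> \<sigma>) (comparison C F \<eta>)"

text \<open>The free/forgetful adjunction; its unit is the unit of the monad.\<close>

definition free_fun ::
  "('o, 'a) cat \<Rightarrow> ('o, 'a, 'o, 'a) functor_data \<Rightarrow> ('o \<Rightarrow> 'a)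
    \<Rightarrow> ('o, 'a, ('o, 'a) module_obj, ('o, 'a) module_arr) functor_data" where
  "free_fun C T m =
     (let \<phi> = (\<lambda>a. (ob T a, m a))
      in \<lparr>ob = \<phi>, ar = (\<lambda>f. (\<phi> (Dom C f), ar T f, \<phi> (Cod C f)))\<rparr>)"

definition forget_fun :: "(('o, 'a) module_obj, ('o, 'a) module_arr, 'o, 'a) functor_data" where
  "forget_fun = \<lparr>ob = (\<lambda>(a, h). a), ar = (\<lambda>(X, f, Y). f)\<rparr>"

definition free_counit ::
  "('o, 'a, 'o, 'a) functor_data \<Rightarrow> ('o \<Rightarrow> 'a) \<Rightarrow> ('o, 'a) module_obj \<Rightarrow> ('o, 'a) module_arr" where
  "free_counit T m = (\<lambda>(a, h). ((ob T a, m a), h, (a, h)))"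


section \<open>Entwinings, lifted comonads and grouplike morphisms\<close>

locale entwining = monad C T m e + comonad C G \<delta> \<epsilon>
  for C :: "('o, 'a) cat" (structure) and T m e G \<delta> \<epsilon> +
  fixes \<Lambda> :: "'o \<Rightarrow> 'a"
  assumes entw_nat: "is_nat_trans C C (T \<circ>\<^sub>F G) (G \<circ>\<^sub>F T) \<Lambda>"
    and entw_mult:
      "x \<in> Obj C \<Longrightarrow> \<Lambda> x \<cdot> m (ob G x) = ar G (m x) \<cdot> \<Lambda> (ob T x) \<cdot> ar T (\<Lambda> x)"
    and entw_comult:
      "x \<in> Obj C \<Longrightarrow> \<delta> (ob T x) \<cdot> \<Lambda> x = ar G (\<Lambda> x) \<cdot> \<Lambda> (ob G x) \<cdot> ar T (\<delta> x)"
    and entw_unit: "x \<in> Obj C \<Longrightarrow> \<Lambda> x \<cdot> e (ob G x) = ar G (e x)"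
    and entw_counit: "x \<in> Obj C \<Longrightarrow> \<epsilon> (ob T x) \<cdot> \<Lambda> x = ar T (\<epsilon> x)"

text \<open>
  In \<open>\<delta> \<cdot> g = g g\<close> the horizontal composite is \<open>G g \<cdot> g\<close>, equal to \<open>g G \<cdot> g\<close> by naturality.
\<close>

locale grouplike = comonad C G \<delta> \<epsilon>
  for C :: "('o, 'a) cat" (structure) and G \<delta> \<epsilon> +
  fixes g :: "'o \<Rightarrow> 'a"
  assumes grouplike_nat: "is_nat_trans C C id_fun G g"
    and grouplike_counit: "x \<in> Obj C \<Longrightarrow> \<epsilon> x \<cdot> g x = Ident C x"
    and grouplike_comult: "x \<in> Obj C \<Longrightarrow> \<delta> x \<cdot> g x = ar G (g x) \<cdot> g x"

definition lift_ob ::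
  "('o, 'a) cat \<Rightarrow> ('o, 'a, 'o, 'a) functor_data \<Rightarrow> ('o \<Rightarrow> 'a)
    \<Rightarrow> ('o, 'a) module_obj \<Rightarrow> ('o, 'a) module_obj" where
  "lift_ob C G \<Lambda> = (\<lambda>(a, h). (ob G a, ar G h \<cdot>\<^bsub>C\<^esub> \<Lambda> a))"

definition lift_fun ::
  "('o, 'a) cat \<Rightarrow> ('o, 'a, 'o, 'a) functor_data \<Rightarrow> ('o \<Rightarrow> 'a)
    \<Rightarrow> (('o, 'a) module_obj, ('o, 'a) module_arr, ('o, 'a) module_obj, ('o, 'a) module_arr)
         functor_data" where
  "lift_fun C G \<Lambda> =
     \<lparr>ob = lift_ob C G \<Lambda>, ar = (\<lambda>(X, f, Y). (lift_ob C G \<Lambda> X, ar G f, lift_ob C G \<Lambda> Y))\<rparr>"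

definition lift_comult ::
  "('o, 'a) cat \<Rightarrow> ('o, 'a, 'o, 'a) functor_data \<Rightarrow> ('o \<Rightarrow> 'a) \<Rightarrow> ('o \<Rightarrow> 'a)
    \<Rightarrow> ('o, 'a) module_obj \<Rightarrow> ('o, 'a) module_arr" where
  "lift_comult C G \<delta> \<Lambda> X =
     (lift_ob C G \<Lambda> X, \<delta> (fst X), lift_ob C G \<Lambda> (lift_ob C G \<Lambda> X))"

definition lift_counit ::
  "('o, 'a) cat \<Rightarrow> ('o, 'a, 'o, 'a) functor_data \<Rightarrow> ('o \<Rightarrow> 'a) \<Rightarrow> ('o \<Rightarrow> 'a)
    \<Rightarrow> ('o, 'a) module_obj \<Rightarrow> ('o, 'a) module_arr" where
  "lift_counit C G \<epsilon> \<Lambda> X = (lift_ob C G \<Lambda> X, \<epsilon> (fst X), X)"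

text \<open>
  The codomain of \<open>K\<^sub>g\<close>. Its objects are pairs of a module \<open>X\<close> and a module morphism
  from \<open>X\<close> to its lift, the latter being a triple.
\<close>

definition entwined_cat ::
  "('o, 'a) cat \<Rightarrow> ('o, 'a, 'o, 'a) functor_data \<Rightarrow> ('o \<Rightarrow> 'a) \<Rightarrow> ('o \<Rightarrow> 'a)
    \<Rightarrow> ('o, 'a, 'o, 'a) functor_data \<Rightarrow> ('o \<Rightarrow> 'a) \<Rightarrow> ('o \<Rightarrow> 'a) \<Rightarrow> ('o \<Rightarrow> 'a)
    \<Rightarrow> ((('o, 'a) module_obj, ('o, 'a) module_arr) module_obj,
        (('o, 'a) module_obj, ('o, 'a) module_arr) module_arr) cat" where
  "entwined_cat C T m e G \<delta> \<epsilon> \<Lambda> =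
     comodule_cat (module_cat C T m e)
       (lift_fun C G \<Lambda>) (lift_comult C G \<delta> \<Lambda>) (lift_counit C G \<epsilon> \<Lambda>)"

definition K_ob ::
  "('o, 'a) cat \<Rightarrow> ('o, 'a, 'o, 'a) functor_data \<Rightarrow> ('o \<Rightarrow> 'a)
    \<Rightarrow> ('o, 'a, 'o, 'a) functor_data \<Rightarrow> ('o \<Rightarrow> 'a) \<Rightarrow> ('o \<Rightarrow> 'a)
    \<Rightarrow> 'o \<Rightarrow> (('o, 'a) module_obj, ('o, 'a) module_arr) module_obj" where
  "K_ob C T m G \<Lambda> g a =
     (let X = (ob T a, m a) in (X, (X, \<Lambda> a \<cdot>\<^bsub>C\<^esub> ar T (g a), lift_ob C G \<Lambda> X)))"

definition K_fun ::
  "('o, 'a) cat \<Rightarrow> ('o, 'a, 'o, 'a) functor_data \<Rightarrow> ('o \<Rightarrow> 'a)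
    \<Rightarrow> ('o, 'a, 'o, 'a) functor_data \<Rightarrow> ('o \<Rightarrow> 'a) \<Rightarrow> ('o \<Rightarrow> 'a)
    \<Rightarrow> ('o, 'a, (('o, 'a) module_obj, ('o, 'a) module_arr) module_obj,
                (('o, 'a) module_obj, ('o, 'a) module_arr) module_arr) functor_data" where
  "K_fun C T m G \<Lambda> g =
     \<lparr>ob = K_ob C T m G \<Lambda> g,
      ar = (\<lambda>f. (K_ob C T m G \<Lambda> g (Dom C f), ar (free_fun C T m) f, K_ob C T m G \<Lambda> g (Cod C f)))\<rparr>"

end

theory Submission
  imports Defs
begin

text \<open>
  The composites \<open>G h \<cdot> \<Lambda>\<^sub>a \<cdot> T (g\<^sub>a)\<close> are the components of a comonad morphism \<open>t\<close> from the
  comonad generated by the free/forgetful adjunction to the lifted comonad, and \<open>K\<^sub>g\<close> is the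
  comparison functor followed by the change of comonad along \<open>t\<close>. If \<open>t\<close> is invertible, this
  change is an isomorphism of categories. It remains to see, for any adjunction with left adjoint
  \<open>F\<close> and right adjoint \<open>R\<close> and any comonad morphism \<open>t\<close> from \<open>F R\<close> to a comonad \<open>G\<close>, that \<open>t\<close>
  is invertible as soon as the composite with the comparison functor is an equivalence. This holds
  because \<open>R d\<close> and the object corresponding to the cofree \<open>G\<close>-comodule on \<open>d\<close> both represent
  the presheaf \<open>c \<mapsto> Hom(F c, d)\<close>.
\<close>

section \<open>Categories, functors and equivalences\<close>

lemma Hom_iff: "f \<in> Hom C x y \<longleftrightarrow> f \<in> Arr C \<and> Dom C f = x \<and> Cod C f = y"
  by (simp add: Hom_def)

section \<open>Composition and isomorphisms in a category\<close>

context category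
begin

lemma ident_simps:
  assumes "x \<in> Obj C"
  shows "Ident C x \<in> Arr C" "Dom C (Ident C x) = x" "Cod C (Ident C x) = x"
  using ident_hom[OF assms] by (simp_all add: Hom_iff)

lemma comp_simps:
  assumes "f \<in> Arr C" "h \<in> Arr C" "Dom C h = Cod C f"
  shows "h \<cdot> f \<in> Arr C" "Dom C (h \<cdot> f) = Dom C f" "Cod C (h \<cdot> f) = Cod C h"
  using comp_hom[of f "Dom C f" "Cod C f" h "Cod C h"] assms by (simp_all add: Hom_iff)

lemma comp_ident:
  assumes "f \<in> Arr C"
  shows "Cod C f = x \<Longrightarrow> Ident C x \<cdot> f = f" "Dom C f = x \<Longrightarrow> f \<cdot> Ident C x = f"
  using ident_left[of f "Dom C f" x] ident_right[of f x "Cod C f"] assms by (simp_all add: Hom_iff)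

lemma comp_assoc_arr:
  assumes "f \<in> Arr C" "h \<in> Arr C" "k \<in> Arr C" "Dom C h = Cod C f" "Dom C k = Cod C h"
  shows "(k \<cdot> h) \<cdot> f = k \<cdot> (h \<cdot> f)"
  using comp_assoc[of f "Dom C f" "Cod C f" h "Cod C h" k "Cod C k"] assms by (simp add: Hom_iff)

lemmas cat_simps = dom_obj cod_obj ident_simps comp_simps comp_ident comp_assoc_arr

text \<open>Chains of composites are kept associated to the right, so the left side of a known
  equation \<open>k \<cdot> h = l\<close> is not a subterm of a longer chain. Composing the equation
  with the tail \<open>f\<close> makes it applicable there.\<close>

lemma comp_extend:
  assumes "k \<cdot> h = l" "f \<in> Arr C" "h \<in> Arr C" "k \<in> Arr C" "Dom C h = Cod C f" "Dom C k = Cod C h"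
  shows "k \<cdot> (h \<cdot> f) = l \<cdot> f"
  using assms comp_assoc_arr by metis

lemma isoI:
  assumes "f \<in> Hom C x y" "h \<in> Hom C y x" "h \<cdot> f = Ident C x" "f \<cdot> h = Ident C y"
  shows "is_iso C f"
  using assms by (auto simp: is_iso_def Hom_iff)

lemma isoE:
  assumes "is_iso C f"
  obtains h where "f \<in> Arr C" "h \<in> Arr C" "Dom C h = Cod C f" "Cod C h = Dom C f"
    "h \<cdot> f = Ident C (Dom C f)" "f \<cdot> h = Ident C (Cod C f)"
  using assms by (auto simp: is_iso_def Hom_iff)

lemma iso_comp:
  assumes "is_iso C f" "is_iso C h" "Dom C h = Cod C f"
  shows "is_iso C (h \<cdot> f)"
proof -
  obtain f' where f: "f \<in> Arr C" "f' \<in> Arr C" "Dom C f' = Cod C f" "Cod C f' = Dom C f"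
    "f' \<cdot> f = Ident C (Dom C f)" "f \<cdot> f' = Ident C (Cod C f)"
    using assms(1) by (rule isoE)
  obtain h' where h: "h \<in> Arr C" "h' \<in> Arr C" "Dom C h' = Cod C h" "Cod C h' = Dom C h"
    "h' \<cdot> h = Ident C (Dom C h)" "h \<cdot> h' = Ident C (Cod C h)"
    using assms(2) by (rule isoE)
  show ?thesis
  proof (rule isoI)
    show "h \<cdot> f \<in> Hom C (Dom C f) (Cod C h)" "f' \<cdot> h' \<in> Hom C (Cod C h) (Dom C f)"
      using f h assms(3) by (simp_all add: Hom_iff cat_simps)
    show "(f' \<cdot> h') \<cdot> (h \<cdot> f) = Ident C (Dom C f)"
      using f h assms(3) by (simp add: cat_simps comp_extend[OF h(5)])
    show "(h \<cdot> f) \<cdot> (f' \<cdot> h') = Ident C (Cod C h)"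
      using f h assms(3) by (simp add: cat_simps comp_extend[OF f(6)])
  qed
qed

lemma iso_mono:
  assumes "is_iso C k" "f \<in> Arr C" "h \<in> Arr C" "Dom C k = Cod C f" "Dom C k = Cod C h"
    "k \<cdot> f = k \<cdot> h"
  shows "f = h"
proof -
  obtain k' where k: "k \<in> Arr C" "k' \<in> Arr C" "Dom C k' = Cod C k" "k' \<cdot> k = Ident C (Dom C k)"
    using assms(1) by (rule isoE)
  have "f = k' \<cdot> (k \<cdot> f)"
    using assms(2,4) k by (simp add: comp_extend[OF k(4)] cat_simps)
  also have "\<dots> = h"
    unfolding assms(6) using assms(3,5) k by (simp add: comp_extend[OF k(4)] cat_simps)
  finally show ?thesis .
qed

lemma iso_epi:
  assumes "is_iso C k" "f \<in> Arr C" "h \<in> Arr C" "Dom C f = Cod C k" "Dom C h = Cod C k"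
    "f \<cdot> k = h \<cdot> k"
  shows "f = h"
proof -
  obtain k' where k: "k \<in> Arr C" "k' \<in> Arr C" "Cod C k' = Dom C k" "k \<cdot> k' = Ident C (Cod C k)"
    using assms(1) by (rule isoE)
  have "f = (f \<cdot> k) \<cdot> k'"
    using assms(2,4) k by (simp add: cat_simps)
  also have "\<dots> = h"
    unfolding assms(6) using assms(3,5) k by (simp add: cat_simps)
  finally show ?thesis .
qed

end

section \<open>Functors, natural transformations and equivalences on explicit carriers\<close>

lemma comp_fun_simps [simp]: "ob (F \<circ>\<^sub>F H) x = ob F (ob H x)" "ar (F \<circ>\<^sub>F H) f = ar F (ar H f)"
  by (simp_all add: comp_fun_def)

lemma id_fun_simps [simp]: "ob id_fun x = x" "ar id_fun f = f"
  by (simp_all add: id_fun_def)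

lemma functorI:
  assumes "category C"
    and "\<And>x. x \<in> Obj C \<Longrightarrow> ob F x \<in> Obj D"
    and "\<And>f. f \<in> Arr C \<Longrightarrow> ar F f \<in> Hom D (ob F (Dom C f)) (ob F (Cod C f))"
    and "\<And>x. x \<in> Obj C \<Longrightarrow> ar F (Ident C x) = Ident D (ob F x)"
    and "\<And>f h. \<lbrakk>f \<in> Arr C; h \<in> Arr C; Dom C h = Cod C f\<rbrakk> \<Longrightarrow>
      ar F (h \<cdot>\<^bsub>C\<^esub> f) = ar F h \<cdot>\<^bsub>D\<^esub> ar F f"
  shows "is_functor C D F"
  using assms by (auto simp: is_functor_def Hom_iff)

lemma functor_ob:
  assumes "is_functor C D F" "x \<in> Obj C"
  shows "ob F x \<in> Obj D" "ar F (Ident C x) = Ident D (ob F x)"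
  using assms by (simp_all add: is_functor_def)

lemma functor_comp:
  assumes "is_functor C D F" "f \<in> Arr C" "h \<in> Arr C" "Dom C h = Cod C f"
  shows "ar F (h \<cdot>\<^bsub>C\<^esub> f) = ar F h \<cdot>\<^bsub>D\<^esub> ar F f"
  using assms by (simp add: is_functor_def)

lemma (in category) functor_ar:
  assumes "is_functor C D F" "f \<in> Arr C"
  shows "ar F f \<in> Arr D" "Dom D (ar F f) = ob F (Dom C f)" "Cod D (ar F f) = ob F (Cod C f)"
proof -
  have "f \<in> Hom C (Dom C f) (Cod C f)"
    using assms(2) by (simp add: Hom_iff)
  then have "ar F f \<in> Hom D (ob F (Dom C f)) (ob F (Cod C f))"
    using assms by (simp add: is_functor_def dom_obj cod_obj)
  then show "ar F f \<in> Arr D" "Dom D (ar F f) = ob F (Dom C f)" "Cod D (ar F f) = ob F (Cod C f)"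
    by (simp_all add: Hom_iff)
qed

lemmas (in category) functor_simps = functor_ob functor_ar functor_comp

lemma nat_transI:
  assumes "\<And>x. x \<in> Obj C \<Longrightarrow> \<tau> x \<in> Hom D (ob F x) (ob H x)"
    and "\<And>f. f \<in> Arr C \<Longrightarrow> \<tau> (Cod C f) \<cdot>\<^bsub>D\<^esub> ar F f = ar H f \<cdot>\<^bsub>D\<^esub> \<tau> (Dom C f)"
  shows "is_nat_trans C D F H \<tau>"
  using assms by (auto simp: is_nat_trans_def)

lemma nat_trans_ob:
  assumes "is_nat_trans C D F H \<tau>" "x \<in> Obj C"
  shows "\<tau> x \<in> Arr D" "Dom D (\<tau> x) = ob F x" "Cod D (\<tau> x) = ob H x"
  using assms by (auto simp: is_nat_trans_def Hom_iff)

lemma nat_trans_nat: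
  assumes "is_nat_trans C D F H \<tau>" "f \<in> Arr C" "Dom C f = x" "Cod C f = y"
  shows "\<tau> y \<cdot>\<^bsub>D\<^esub> ar F f = ar H f \<cdot>\<^bsub>D\<^esub> \<tau> x"
  using assms by (auto simp: is_nat_trans_def)

lemma functor_iso:
  assumes "category C" "category D" "is_functor C D F" "is_iso C f"
  shows "is_iso D (ar F f)"
proof -
  interpret C: category C by fact
  interpret D: category D by fact
  note [simp] = C.cat_simps D.cat_simps C.functor_simps[OF assms(3)]
  obtain h where h: "f \<in> Arr C" "h \<in> Arr C" "Dom C h = Cod C f" "Cod C h = Dom C f"
    "h \<cdot>\<^bsub>C\<^esub> f = Ident C (Dom C f)" "f \<cdot>\<^bsub>C\<^esub> h = Ident C (Cod C f)"
    using assms(4) by (rule C.isoE)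
  show ?thesis
    using h C.functor_simps(6)[OF assms(3), of f h] C.functor_simps(6)[OF assms(3), of h f]
    by (intro D.isoI[of _ "ob F (Dom C f)" "ob F (Cod C f)" "ar F h"]) (auto simp: Hom_iff)
qed

text \<open>Naturality of the isomorphism \<tau> gives \<open>f \<cdot> \<tau> (Dom C f) = \<tau>
  (Cod C f) \<cdot> ar Q (ar F f)\<close>, so the left side depends only on \<open>ar F f\<close>
  and the endpoints of \<open>f\<close>; the invertible \<tau> then cancels.\<close>

lemma faithful_if_left_inverse:
  assumes "category C" and "naturally_isomorphic C C (Q \<circ>\<^sub>F F) id_fun"
    and "f \<in> Arr C" "f' \<in> Arr C" "Dom C f = Dom C f'" "Cod C f = Cod C f'" "ar F f = ar F f'"
  shows "f = f'"
proof -
  interpret C: category C by fact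
  obtain \<tau> where \<tau>: "is_nat_trans C C (Q \<circ>\<^sub>F F) id_fun \<tau>" "\<And>x. x \<in> Obj C \<Longrightarrow> is_iso C (\<tau> x)"
    using assms(2) by (auto simp: naturally_isomorphic_def)
  have "f \<cdot>\<^bsub>C\<^esub> \<tau> (Dom C f) = f' \<cdot>\<^bsub>C\<^esub> \<tau> (Dom C f)"
    using nat_trans_nat[OF \<tau>(1), of f] nat_trans_nat[OF \<tau>(1), of f'] assms by simp
  then show ?thesis
    by (rule C.iso_epi[rotated 5])
      (use assms nat_trans_ob[OF \<tau>(1)] \<tau>(2) in \<open>simp_all add: C.dom_obj\<close>)
qed

text \<open>Conjugating \<open>ar Q f\<close> with \<tau> yields a candidate \<open>v\<close>, and
  naturality of \<tau> shows that \<open>Q F v = Q f\<close>. The other natural isomorphism, from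
  \<open>F Q\<close> to the identity, makes \<open>Q\<close> faithful, so
  \<open>F v = f\<close>.\<close>

lemma equivalence_full:
  assumes "category C" "category D" "is_equivalence C D F"
    and "x \<in> Obj C" "y \<in> Obj C" "f \<in> Hom D (ob F x) (ob F y)"
  obtains v where "v \<in> Hom C x y" "ar F v = f"
proof -
  interpret C: category C by fact
  interpret D: category D by fact
  obtain Q where F: "is_functor C D F" and Q: "is_functor D C Q"
    and QF: "naturally_isomorphic C C (Q \<circ>\<^sub>F F) id_fun"
    and FQ: "naturally_isomorphic D D (F \<circ>\<^sub>F Q) id_fun"
    using assms(3) by (auto simp: is_equivalence_def)
  obtain \<tau> where \<tau>: "is_nat_trans C C (Q \<circ>\<^sub>F F) id_fun \<tau>" "\<And>x. x \<in> Obj C \<Longrightarrow> is_iso C (\<tau> x)"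
    using QF by (auto simp: naturally_isomorphic_def)
  note [simp] = C.cat_simps D.cat_simps C.functor_simps[OF F] D.functor_simps[OF Q]
    nat_trans_ob[OF \<tau>(1)]
  obtain i where i: "i \<in> Arr C" "Dom C i = x" "Cod C i = ob Q (ob F x)"
    "i \<cdot>\<^bsub>C\<^esub> \<tau> x = Ident C (ob Q (ob F x))"
    using \<tau>(2)[OF assms(4)] assms(4) by (elim C.isoE) simp
  have f: "f \<in> Arr D" "Dom D f = ob F x" "Cod D f = ob F y"
    using assms(6) by (simp_all add: Hom_iff)
  define v where "v = \<tau> y \<cdot>\<^bsub>C\<^esub> ar Q f \<cdot>\<^bsub>C\<^esub> i"
  have v: "v \<in> Arr C" "Dom C v = x" "Cod C v = y"
    using f i assms(4,5) by (simp_all add: v_def)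
  have "\<tau> y \<cdot>\<^bsub>C\<^esub> ar Q (ar F v) = v \<cdot>\<^bsub>C\<^esub> \<tau> x"
    using nat_trans_nat[OF \<tau>(1), of v] v by simp
  also have "\<dots> = \<tau> y \<cdot>\<^bsub>C\<^esub> ar Q f"
    using f i assms(4,5) by (simp add: v_def)
  finally have "ar Q (ar F v) = ar Q f"
    by (rule C.iso_mono[rotated 5]) (use f v assms(4,5) \<tau>(2) in simp_all)
  then have "ar F v = f"
    by (rule faithful_if_left_inverse[OF assms(2) FQ, rotated 4]) (use f v in simp_all)
  then show ?thesis
    using that v by (simp add: Hom_iff)
qed

text \<open>Functors are total functions whose laws speak only of the carriers. Two functors that
  agree on the carriers may still differ as records, so one cannot simply be rewritten into the
  other.\<close>

lemma is_equivalence_cong: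
  assumes "category C" "category D" and "\<And>x. x \<in> Obj C \<Longrightarrow> ob F x = ob F' x"
    and "\<And>f. f \<in> Arr C \<Longrightarrow> ar F f = ar F' f"
  shows "is_equivalence C D F \<longleftrightarrow> is_equivalence C D F'"
proof -
  interpret C: category C by fact
  interpret D: category D by fact
  have 1: "is_functor C D F \<longleftrightarrow> is_functor C D F'"
    using assms(3,4) by (simp add: is_functor_def Hom_iff C.cat_simps)
  have 2: "naturally_isomorphic C C (Q \<circ>\<^sub>F F) id_fun \<longleftrightarrow>
      naturally_isomorphic C C (Q \<circ>\<^sub>F F') id_fun" for Q
    using assms(3,4) by (simp add: naturally_isomorphic_def is_nat_trans_def)
  \<comment> \<open>Here \<open>F\<close> is evaluated at values of \<open>Q\<close>, which lie in
    the carriers of \<open>C\<close> because \<open>Q\<close> is a functor.\<close>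
  have 3: "naturally_isomorphic D D (F \<circ>\<^sub>F Q) id_fun \<longleftrightarrow>
      naturally_isomorphic D D (F' \<circ>\<^sub>F Q) id_fun" if "is_functor D C Q" for Q
    using assms(3,4) D.functor_simps[OF that]
    by (simp add: naturally_isomorphic_def is_nat_trans_def)
  show ?thesis
    unfolding is_equivalence_def 1 2 using 3 by (metis (no_types))
qed

text \<open>\<open>S\<close> is an isomorphism of categories with inverse \<open>S'\<close>, both
  identities being required on the carriers. A quasi-inverse \<open>Q\<close> of \<open>F\<close>
  gives the quasi-inverse \<open>Q \<circ>\<^sub>F S'\<close>, and the isomorphism \<tau> from
  \<open>F Q\<close> to the identity is transported to \<open>S \<tau> S'\<close>.\<close>

lemma is_equivalence_comp_iso:
  assumes "category C" "category D" "category E" "is_equivalence C D F"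
    and S: "is_functor D E S" and S': "is_functor E D S'"
    and S'S: "\<And>y. y \<in> Obj D \<Longrightarrow> ob S' (ob S y) = y" "\<And>f. f \<in> Arr D \<Longrightarrow> ar S' (ar S f) = f"
    and SS': "\<And>z. z \<in> Obj E \<Longrightarrow> ob S (ob S' z) = z" "\<And>f. f \<in> Arr E \<Longrightarrow> ar S (ar S' f) = f"
  shows "is_equivalence C E (S \<circ>\<^sub>F F)"
proof -
  interpret C: category C by fact
  interpret D: category D by fact
  interpret E: category E by fact
  obtain Q where F: "is_functor C D F" and Q: "is_functor D C Q"
    and QF: "naturally_isomorphic C C (Q \<circ>\<^sub>F F) id_fun"
    and FQ: "naturally_isomorphic D D (F \<circ>\<^sub>F Q) id_fun"
    using assms(4) by (auto simp: is_equivalence_def)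
  obtain \<tau> where \<tau>: "is_nat_trans D D (F \<circ>\<^sub>F Q) id_fun \<tau>" "\<And>x. x \<in> Obj D \<Longrightarrow> is_iso D (\<tau> x)"
    using FQ by (auto simp: naturally_isomorphic_def)
  note [simp] = C.cat_simps D.cat_simps E.cat_simps C.functor_simps[OF F] D.functor_simps[OF Q]
    D.functor_simps[OF S] E.functor_simps[OF S'] S'S SS' nat_trans_ob[OF \<tau>(1)]
  have "is_functor C E (S \<circ>\<^sub>F F)" "is_functor E C (Q \<circ>\<^sub>F S')"
    by (rule functorI; simp add: Hom_iff assms(1,3))+
  moreover have "naturally_isomorphic C C ((Q \<circ>\<^sub>F S') \<circ>\<^sub>F (S \<circ>\<^sub>F F)) id_fun"
    using QF by (simp add: naturally_isomorphic_def is_nat_trans_def)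
  moreover have "naturally_isomorphic E E ((S \<circ>\<^sub>F F) \<circ>\<^sub>F (Q \<circ>\<^sub>F S')) id_fun"
    unfolding naturally_isomorphic_def
  proof (intro exI[of _ "\<lambda>z. ar S (\<tau> (ob S' z))"] conjI ballI nat_transI)
    fix f assume f: "f \<in> Arr E"
    have "ar S (\<tau> (ob S' (Cod E f)) \<cdot>\<^bsub>D\<^esub> ar F (ar Q (ar S' f))) = ar S (ar S' f \<cdot>\<^bsub>D\<^esub> \<tau> (ob S' (Dom E f)))"
      using f nat_trans_nat[OF \<tau>(1), of "ar S' f"] by simp
    then show "ar S (\<tau> (ob S' (Cod E f))) \<cdot>\<^bsub>E\<^esub> ar ((S \<circ>\<^sub>F F) \<circ>\<^sub>F Q \<circ>\<^sub>F S') f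
        = ar id_fun f \<cdot>\<^bsub>E\<^esub> ar S (\<tau> (ob S' (Dom E f)))"
      using f by simp
  qed (use \<tau>(2) in \<open>simp_all add: Hom_iff functor_iso[OF assms(2,3) S]\<close>)
  ultimately show ?thesis
    unfolding is_equivalence_def by blast
qed

section \<open>Comonads, comodules and comonad morphisms\<close>

context comonad
begin

lemma comodule_cat_simps:
  "Obj (comodule_cat C G \<delta> \<epsilon>) = {X. is_comodule C G \<delta> \<epsilon> X}"
  "(X, f, Y) \<in> Arr (comodule_cat C G \<delta> \<epsilon>) \<longleftrightarrow>
     is_comodule C G \<delta> \<epsilon> X \<and> is_comodule C G \<delta> \<epsilon> Y \<and> f \<in> comodule_hom C G X Y"
  "Dom (comodule_cat C G \<delta> \<epsilon>) (X, f, Y) = X"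
  "Cod (comodule_cat C G \<delta> \<epsilon>) (X, f, Y) = Y"
  "Ident (comodule_cat C G \<delta> \<epsilon>) X = (X, Ident C (fst X), X)"
  "(Y', h, Z) \<cdot>\<^bsub>comodule_cat C G \<delta> \<epsilon>\<^esub> (X, f, Y) = (X, h \<cdot> f, Z)"
  by (simp_all add: comodule_cat_def)

lemma is_comodule_iff:
  "is_comodule C G \<delta> \<epsilon> (a, \<theta>) \<longleftrightarrow> a \<in> Obj C \<and> \<theta> \<in> Arr C \<and> Dom C \<theta> = a \<and> Cod C \<theta> = ob G a \<and>
     \<epsilon> a \<cdot> \<theta> = Ident C a \<and> \<delta> a \<cdot> \<theta> = ar G \<theta> \<cdot> \<theta>"
  by (auto simp: is_comodule_def Hom_iff)

lemma comodule_hom_iff: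
  "f \<in> comodule_hom C G (a, \<theta>) (b, \<kappa>) \<longleftrightarrow>
     f \<in> Arr C \<and> Dom C f = a \<and> Cod C f = b \<and> \<kappa> \<cdot> f = ar G f \<cdot> \<theta>"
  by (auto simp: comodule_hom_def Hom_iff)

lemmas comonad_simps = functor_simps[OF comonad_functor] nat_trans_ob[OF comult_nat, simplified]
  nat_trans_ob[OF counit_nat, simplified]

lemma category_comodule_cat: "category (comodule_cat C G \<delta> \<epsilon>)"
proof
  let ?E = "comodule_cat C G \<delta> \<epsilon>"
  note [simp] = comodule_cat_simps is_comodule_iff comodule_hom_iff cat_simps comonad_simps Hom_iff
  {
    fix f assume "f \<in> Arr ?E"
    then show "Dom ?E f \<in> Obj ?E" "Cod ?E f \<in> Obj ?E"
      by (cases f; simp)+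
  next
    fix X assume "X \<in> Obj ?E"
    then show "Ident ?E X \<in> Hom ?E X X"
      by (cases X) simp
  next
    fix f h X Y Z
    assume f: "f \<in> Hom ?E X Y" and h: "h \<in> Hom ?E Y Z"
    obtain a \<theta> b \<kappa> c \<mu> f' h' where eq: "X = (a, \<theta>)" "Y = (b, \<kappa>)" "Z = (c, \<mu>)"
      "f = (X, f', Y)" "h = (Y, h', Z)"
      using f h by (cases X; cases Y; cases Z; cases f; cases h) simp
    have "\<mu> \<cdot> (h' \<cdot> f') = (ar G h' \<cdot> \<kappa>) \<cdot> f'"
      using f h eq by (intro comp_extend) simp_all
    also have "\<dots> = (ar G h' \<cdot> ar G f') \<cdot> \<theta>"
      using f h eq by simp
    finally show "h \<cdot>\<^bsub>?E\<^esub> f \<in> Hom ?E X Z"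
      using f h eq by simp
  next
    fix f X Y assume f: "f \<in> Hom ?E X Y"
    obtain f' where eq: "f = (X, f', Y)"
      using f by (cases f) simp
    show "Ident ?E Y \<cdot>\<^bsub>?E\<^esub> f = f" "f \<cdot>\<^bsub>?E\<^esub> Ident ?E X = f"
      using f eq by (cases X; cases Y; simp)+
  next
    fix f h k W X Y Z
    assume f: "f \<in> Hom ?E W X" and h: "h \<in> Hom ?E X Y"
      and k: "k \<in> Hom ?E Y Z"
    obtain f' h' k' where eq: "f = (W, f', X)" "h = (X, h', Y)" "k = (Y, k', Z)"
      using f h k by (cases f; cases h; cases k) simp
    show "(k \<cdot>\<^bsub>?E\<^esub> h) \<cdot>\<^bsub>?E\<^esub> f
        = k \<cdot>\<^bsub>?E\<^esub> (h \<cdot>\<^bsub>?E\<^esub> f)"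
      using f h k eq by (cases W; cases X; cases Y; cases Z) simp
  }
qed

end

text \<open>In the law \<open>\<delta>' \<cdot> t = (t t) \<cdot> \<delta>\<close> the horizontal
  composite \<open>t t\<close> is written as \<open>G t \<cdot> t H\<close>, and the chain is
  associated to the right to match the normal form of composites.\<close>

definition comonad_morphism ::
  "('o, 'a) cat \<Rightarrow> ('o, 'a, 'o, 'a) functor_data \<Rightarrow> ('o \<Rightarrow> 'a) \<Rightarrow> ('o \<Rightarrow> 'a)
    \<Rightarrow> ('o, 'a, 'o, 'a) functor_data \<Rightarrow> ('o \<Rightarrow> 'a) \<Rightarrow> ('o \<Rightarrow> 'a) \<Rightarrow> ('o \<Rightarrow> 'a) \<Rightarrow> bool" where
  "comonad_morphism C H \<delta> \<epsilon> G \<delta>' \<epsilon>' t \<longleftrightarrow> is_nat_trans C C H G t \<and>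
     (\<forall>x \<in> Obj C. \<epsilon>' x \<cdot>\<^bsub>C\<^esub> t x = \<epsilon> x) \<and>
     (\<forall>x \<in> Obj C. \<delta>' x \<cdot>\<^bsub>C\<^esub> t x = ar G (t x) \<cdot>\<^bsub>C\<^esub> (t (ob H x) \<cdot>\<^bsub>C\<^esub> \<delta> x))"

section \<open>Change of comonad along a comonad morphism\<close>

definition push_ob ::
  "('o, 'a) cat \<Rightarrow> ('o \<Rightarrow> 'a) \<Rightarrow> ('o, 'a) module_obj \<Rightarrow> ('o, 'a) module_obj" where
  "push_ob C t = (\<lambda>(x, \<theta>). (x, t x \<cdot>\<^bsub>C\<^esub> \<theta>))"

definition push_fun ::
  "('o, 'a) cat \<Rightarrow> ('o \<Rightarrow> 'a)
    \<Rightarrow> (('o, 'a) module_obj, ('o, 'a) module_arr, ('o, 'a) module_obj, ('o, 'a) module_arr)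
         functor_data" where
  "push_fun C t = \<lparr>ob = push_ob C t, ar = (\<lambda>(X, f, Y). (push_ob C t X, f, push_ob C t Y))\<rparr>"

lemma push_fun_simps:
  "ob (push_fun C t) X = push_ob C t X"
  "ar (push_fun C t) (X, f, Y) = (push_ob C t X, f, push_ob C t Y)"
  "push_ob C t (x, \<theta>) = (x, t x \<cdot>\<^bsub>C\<^esub> \<theta>)"
  by (simp_all add: push_fun_def push_ob_def)

locale comonad_pair = H: comonad C H \<delta> \<epsilon> + G: comonad C G \<delta>' \<epsilon>'
  for C :: "('o, 'a) cat" (structure) and H \<delta> \<epsilon> G \<delta>' \<epsilon>' +
  fixes t
  assumes morphism: "comonad_morphism C H \<delta> \<epsilon> G \<delta>' \<epsilon>' t"
begin

lemma t_nat_trans: "is_nat_trans C C H G t"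
  and t_counit: "x \<in> Obj C \<Longrightarrow> \<epsilon>' x \<cdot> t x = \<epsilon> x"
  and t_comult: "x \<in> Obj C \<Longrightarrow> \<delta>' x \<cdot> t x = ar G (t x) \<cdot> (t (ob H x) \<cdot> \<delta> x)"
  using morphism by (simp_all add: comonad_morphism_def)

lemmas pair_simps = H.cat_simps H.comonad_simps G.comonad_simps nat_trans_ob[OF t_nat_trans]

text \<open>The counit law of the new coaction comes from \<open>t_counit\<close>. For
  coassociativity, \<open>t_comult\<close> produces \<open>\<delta> a \<cdot> \<theta>\<close>,
  coassociativity of \<theta> rewrites it, and naturality of \<open>t\<close> at \<theta> moves
  \<open>t\<close> past \<theta>.\<close>

lemma push_comodule:
  assumes "is_comodule C H \<delta> \<epsilon> X"
  shows "is_comodule C G \<delta>' \<epsilon>' (push_ob C t X)"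
proof -
  note [simp] = pair_simps
  obtain a \<theta> where X: "X = (a, \<theta>)"
    by (cases X)
  have \<theta>: "a \<in> Obj C" "\<theta> \<in> Arr C" "Dom C \<theta> = a" "Cod C \<theta> = ob H a"
    "\<epsilon> a \<cdot> \<theta> = Ident C a" "\<delta> a \<cdot> \<theta> = ar H \<theta> \<cdot> \<theta>"
    using assms by (simp_all add: X H.is_comodule_iff)
  have counit: "\<epsilon>' a \<cdot> t a \<cdot> \<theta> = Ident C a"
    using \<theta> by (subst H.comp_extend[OF t_counit]) simp_all
  have "\<delta>' a \<cdot> t a \<cdot> \<theta> = ar G (t a) \<cdot> t (ob H a) \<cdot> \<delta> a \<cdot> \<theta>"
    using \<theta>(1-4) by (subst H.comp_extend[OF t_comult]) simp_all
  also have "\<dots> = ar G (t a) \<cdot> (t (ob H a) \<cdot> ar H \<theta>) \<cdot> \<theta>"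
    using \<theta> by simp
  also have "\<dots> = ar G (t a) \<cdot> (ar G \<theta> \<cdot> t a) \<cdot> \<theta>"
    using \<theta>(1-4) by (simp only: nat_trans_nat[OF t_nat_trans])
  finally show ?thesis
    using \<theta>(1-4) counit by (simp add: X push_fun_simps G.is_comodule_iff)
qed

lemma push_functor: "is_functor (comodule_cat C H \<delta> \<epsilon>) (comodule_cat C G \<delta>' \<epsilon>') (push_fun C t)"
proof (rule functorI)
  show "category (comodule_cat C H \<delta> \<epsilon>)"
    by (rule H.category_comodule_cat)
next
  fix f assume f: "f \<in> Arr (comodule_cat C H \<delta> \<epsilon>)"
  note [simp] = pair_simps
  obtain a \<theta> b \<kappa> f' where eq: "f = ((a, \<theta>), f', (b, \<kappa>))"
    by (metis surj_pair)
  have f': "f' \<in> Arr C" "Dom C f' = a" "Cod C f' = b" "\<kappa> \<cdot> f' = ar H f' \<cdot> \<theta>"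
    "a \<in> Obj C" "b \<in> Obj C" "\<theta> \<in> Arr C" "Dom C \<theta> = a" "Cod C \<theta> = ob H a"
    "\<kappa> \<in> Arr C" "Dom C \<kappa> = b" "Cod C \<kappa> = ob H b"
    using f by (simp_all add: eq H.comodule_cat_simps H.comodule_hom_iff H.is_comodule_iff)
  have "(t b \<cdot> \<kappa>) \<cdot> f' = (t b \<cdot> ar H f') \<cdot> \<theta>"
    using f' by simp
  also have "\<dots> = (ar G f' \<cdot> t a) \<cdot> \<theta>"
    using f' by (simp only: nat_trans_nat[OF t_nat_trans])
  finally have "f' \<in> comodule_hom C G (push_ob C t (a, \<theta>)) (push_ob C t (b, \<kappa>))"
    using f' by (simp add: push_fun_simps G.comodule_hom_iff)
  then show "ar (push_fun C t) f \<in> Hom (comodule_cat C G \<delta>' \<epsilon>')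
      (ob (push_fun C t) (Dom (comodule_cat C H \<delta> \<epsilon>) f))
      (ob (push_fun C t) (Cod (comodule_cat C H \<delta> \<epsilon>) f))"
    using f push_comodule[of "(a, \<theta>)"] push_comodule[of "(b, \<kappa>)"]
    by (simp add: eq Hom_iff push_fun_simps H.comodule_cat_simps G.comodule_cat_simps)
next
  fix X assume "X \<in> Obj (comodule_cat C H \<delta> \<epsilon>)"
  then show "ob (push_fun C t) X \<in> Obj (comodule_cat C G \<delta>' \<epsilon>')"
    by (simp add: push_comodule H.comodule_cat_simps G.comodule_cat_simps push_fun_simps(1))
qed (auto simp: H.comodule_cat_simps G.comodule_cat_simps push_fun_def push_ob_def
      split: prod.splits)

text \<open>The inverses are given object by object; naturality and the comonad laws follow from
  those of \<open>t\<close> by inserting \<open>t x \<cdot> s x\<close> and cancelling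
  \<open>s x \<cdot> t x\<close>.\<close>

lemma inverse_comonad_morphism:
  assumes s: "\<And>x. x \<in> Obj C \<Longrightarrow> s x \<in> Hom C (ob G x) (ob H x)"
    and st: "\<And>x. x \<in> Obj C \<Longrightarrow> s x \<cdot> t x = Ident C (ob H x)"
    and ts: "\<And>x. x \<in> Obj C \<Longrightarrow> t x \<cdot> s x = Ident C (ob G x)"
  shows "comonad_morphism C G \<delta>' \<epsilon>' H \<delta> \<epsilon> s"
proof -
  note [simp] = pair_simps
  have [simp]: "s x \<in> Arr C" "Dom C (s x) = ob G x" "Cod C (s x) = ob H x" if "x \<in> Obj C" for x
    using s[OF that] by (simp_all add: Hom_iff)
  have nat: "s (Cod C f) \<cdot> ar G f = ar H f \<cdot> s (Dom C f)" if f: "f \<in> Arr C" for f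
  proof -
    have "s (Cod C f) \<cdot> ar G f = s (Cod C f) \<cdot> ar G f \<cdot> t (Dom C f) \<cdot> s (Dom C f)"
      using f by (simp add: ts)
    also have "\<dots> = s (Cod C f) \<cdot> (t (Cod C f) \<cdot> ar H f) \<cdot> s (Dom C f)"
      using f by (simp add: nat_trans_nat[OF t_nat_trans])
    also have "\<dots> = ar H f \<cdot> s (Dom C f)"
      using f by (simp add: H.comp_extend[OF st])
    finally show ?thesis .
  qed
  then have s_nat: "is_nat_trans C C G H s"
    by (intro nat_transI s)
  have counit: "\<epsilon> x \<cdot> s x = \<epsilon>' x" if x: "x \<in> Obj C" for x
    using x by (simp add: t_counit[symmetric] ts)
  have comult: "\<delta> x \<cdot> s x = ar H (s x) \<cdot> (s (ob G x) \<cdot> \<delta>' x)" if x: "x \<in> Obj C" for x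
  proof -
    \<comment> \<open>Inserting \<open>t x \<cdot> s x\<close> to the right of
      \<open>\<delta>' x\<close> exposes the left side of \<open>t_comult\<close>. Naturality of
      \<open>s\<close> at \<open>t x\<close> then lets \<open>s (ob H x)\<close> meet
      \<open>t (ob H x)\<close> and cancel.\<close>
    have "s (ob G x) \<cdot> \<delta>' x = s (ob G x) \<cdot> (\<delta>' x \<cdot> t x) \<cdot> s x"
      using x by (simp add: ts)
    also have "\<dots> = (s (ob G x) \<cdot> ar G (t x)) \<cdot> t (ob H x) \<cdot> \<delta> x \<cdot> s x"
      using x by (simp add: t_comult)
    also have "\<dots> = (ar H (t x) \<cdot> s (ob H x)) \<cdot> t (ob H x) \<cdot> \<delta> x \<cdot> s x"
      using x by (simp only: nat_trans_nat[OF s_nat] pair_simps)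
    also have "\<dots> = ar H (t x) \<cdot> \<delta> x \<cdot> s x"
      using x by (simp add: H.comp_extend[OF st])
    finally have "ar H (s x) \<cdot> (s (ob G x) \<cdot> \<delta>' x) = ar H (s x \<cdot> t x) \<cdot> \<delta> x \<cdot> s x"
      using x by simp
    then show ?thesis
      using x st by simp
  qed
  show ?thesis
    unfolding comonad_morphism_def using s_nat counit comult by blast
qed

text \<open>Pushing along \<open>t\<close> and pushing along its pointwise inverse \<open>s\<close>
  are mutually inverse functors between the comodule categories, so composing with either one
  preserves equivalences.\<close>

lemma push_equivalence_iff:
  assumes iso: "\<And>x. x \<in> Obj C \<Longrightarrow> is_iso C (t x)" and "category B"
    and K: "is_functor B (comodule_cat C H \<delta> \<epsilon>) K"
  shows "is_equivalence B (comodule_cat C G \<delta>' \<epsilon>') (push_fun C t \<circ>\<^sub>F K) \<longleftrightarrow>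
    is_equivalence B (comodule_cat C H \<delta> \<epsilon>) K"
proof -
  note [simp] = pair_simps
  have "\<forall>x \<in> Obj C. \<exists>s. s \<in> Hom C (ob G x) (ob H x) \<and> s \<cdot> t x = Ident C (ob H x)
      \<and> t x \<cdot> s = Ident C (ob G x)"
    using iso by (auto simp: is_iso_def)
  then obtain s where s: "\<And>x. x \<in> Obj C \<Longrightarrow> s x \<in> Hom C (ob G x) (ob H x)"
    and st: "\<And>x. x \<in> Obj C \<Longrightarrow> s x \<cdot> t x = Ident C (ob H x)"
    and ts: "\<And>x. x \<in> Obj C \<Longrightarrow> t x \<cdot> s x = Ident C (ob G x)"
    by metis
  have [simp]: "s x \<in> Arr C" "Dom C (s x) = ob G x" "Cod C (s x) = ob H x" if "x \<in> Obj C" for x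
    using s[OF that] by (simp_all add: Hom_iff)
  interpret inv: comonad_pair C G \<delta>' \<epsilon>' H \<delta> \<epsilon> s
    by unfold_locales (rule inverse_comonad_morphism[OF s st ts])
  have HG: "push_ob C s (push_ob C t X) = X" if "is_comodule C H \<delta> \<epsilon> X" for X
    using that by (cases X) (simp add: push_fun_simps H.is_comodule_iff H.comp_extend[OF st])
  have GH: "push_ob C t (push_ob C s X) = X" if "is_comodule C G \<delta>' \<epsilon>' X" for X
    using that by (cases X) (simp add: push_fun_simps G.is_comodule_iff H.comp_extend[OF ts])
  have HG': "ar (push_fun C s) (ar (push_fun C t) f) = f" if "f \<in> Arr (comodule_cat C H \<delta> \<epsilon>)" for f
    using that by (cases f) (simp add: push_fun_simps(1,2) H.comodule_cat_simps HG)
  have GH': "ar (push_fun C t) (ar (push_fun C s) f) = f" if "f \<in> Arr (comodule_cat C G \<delta>' \<epsilon>')" for f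
    using that by (cases f) (simp add: push_fun_simps(1,2) G.comodule_cat_simps GH)
  interpret B: category B by fact
  note cats = H.category_comodule_cat G.category_comodule_cat
  show ?thesis
  proof
    assume "is_equivalence B (comodule_cat C H \<delta> \<epsilon>) K"
    from is_equivalence_comp_iso[OF assms(2) cats this push_functor inv.push_functor]
    show "is_equivalence B (comodule_cat C G \<delta>' \<epsilon>') (push_fun C t \<circ>\<^sub>F K)"
      by (simp add: HG GH HG' GH' push_fun_simps H.comodule_cat_simps G.comodule_cat_simps)
  next
    assume "is_equivalence B (comodule_cat C G \<delta>' \<epsilon>') (push_fun C t \<circ>\<^sub>F K)"
    from is_equivalence_comp_iso[OF assms(2) cats(2,1) this inv.push_functor push_functor]
    have "is_equivalence B (comodule_cat C H \<delta> \<epsilon>) (push_fun C s \<circ>\<^sub>F push_fun C t \<circ>\<^sub>F K)"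
      by (simp add: HG GH HG' GH' push_fun_simps H.comodule_cat_simps G.comodule_cat_simps)
    \<comment> \<open>Pushing forth and back is the identity on actual comodules only, so this
      composite is known to agree with \<open>K\<close> just on the carriers of
      \<open>B\<close>.\<close>
    also have "is_equivalence B (comodule_cat C H \<delta> \<epsilon>) (push_fun C s \<circ>\<^sub>F push_fun C t \<circ>\<^sub>F K) \<longleftrightarrow>
        is_equivalence B (comodule_cat C H \<delta> \<epsilon>) K"
    proof (rule is_equivalence_cong[OF assms(2) cats(1)])
      fix x assume "x \<in> Obj B"
      then show "ob (push_fun C s \<circ>\<^sub>F push_fun C t \<circ>\<^sub>F K) x = ob K x"
        using B.functor_simps(1)[OF K] by (simp add: push_fun_simps H.comodule_cat_simps HG)
    next
      fix f assume "f \<in> Arr B"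
      then show "ar (push_fun C s \<circ>\<^sub>F push_fun C t \<circ>\<^sub>F K) f = ar K f"
        using B.functor_simps(3)[OF K] by (simp add: HG')
    qed
    finally show "is_equivalence B (comodule_cat C H \<delta> \<epsilon>) K" .
  qed
qed

end

section \<open>Comonads generated by adjunctions\<close>

locale adjunction = C: category C + D: category D
  for C :: "('o, 'a) cat" and D :: "('p, 'b) cat" +
  fixes F R \<eta> \<sigma>
  assumes adj: "is_adjunction C D F R \<eta> \<sigma>"
begin

lemma left_functor: "is_functor C D F"
  and right_functor: "is_functor D C R"
  and unit_nat: "is_nat_trans C C id_fun (R \<circ>\<^sub>F F) \<eta>"
  and counit_nat: "is_nat_trans D D (F \<circ>\<^sub>F R) id_fun \<sigma>"
  and triangle_left: "c \<in> Obj C \<Longrightarrow> \<sigma> (ob F c) \<cdot>\<^bsub>D\<^esub> ar F (\<eta> c) = Ident D (ob F c)"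
  and triangle_right: "d \<in> Obj D \<Longrightarrow> ar R (\<sigma> d) \<cdot>\<^bsub>C\<^esub> \<eta> (ob R d) = Ident C (ob R d)"
  using adj by (simp_all add: is_adjunction_def)

lemmas adj_simps = C.cat_simps D.cat_simps C.functor_simps[OF left_functor]
  D.functor_simps[OF right_functor] nat_trans_ob[OF unit_nat, simplified]
  nat_trans_ob[OF counit_nat, simplified]

lemmas unit_natural = nat_trans_nat[OF unit_nat, simplified]
lemmas counit_natural = nat_trans_nat[OF counit_nat, simplified]

lemma triangle_right_image:
  assumes "d \<in> Obj D"
  shows "ar F (ar R (\<sigma> d)) \<cdot>\<^bsub>D\<^esub> ar F (\<eta> (ob R d)) = Ident D (ob F (ob R d))"
  using assms triangle_right[OF assms] C.functor_simps(6)[OF left_functor, of "\<eta> (ob R d)" "ar R (\<sigma> d)"]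
  by (simp add: adj_simps)

text \<open>With \<open>f\<close> a component of the unit this is coassociativity of
  \<open>F \<eta> R\<close> and of the coaction \<open>F \<eta>\<close>; with \<open>f\<close> of
  the form \<open>ar R k\<close> it is naturality of \<open>F \<eta> R\<close>; for general
  \<open>f\<close> it says that \<open>ar F f\<close> is a morphism of comparison comodules.\<close>

lemma unit_natural_image:
  assumes "f \<in> Arr C" "Dom C f = x" "Cod C f = y"
  shows "ar F (\<eta> y) \<cdot>\<^bsub>D\<^esub> ar F f = ar F (ar R (ar F f)) \<cdot>\<^bsub>D\<^esub> ar F (\<eta> x)"
proof -
  have "ar F (\<eta> y \<cdot>\<^bsub>C\<^esub> f) = ar F (ar R (ar F f) \<cdot>\<^bsub>C\<^esub> \<eta> x)"
    using unit_natural[OF assms] by simp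
  then show ?thesis
    using assms by (auto simp: adj_simps)
qed

lemma adjunction_comonad: "comonad D (F \<circ>\<^sub>F R) (\<lambda>d. ar F (\<eta> (ob R d))) \<sigma>"
proof
  note [simp] = adj_simps Hom_iff
  show "is_functor D D (F \<circ>\<^sub>F R)"
    by (rule functorI) (simp_all add: D.category_axioms)
  show "is_nat_trans D D (F \<circ>\<^sub>F R) ((F \<circ>\<^sub>F R) \<circ>\<^sub>F F \<circ>\<^sub>F R) (\<lambda>d. ar F (\<eta> (ob R d)))"
    by (rule nat_transI) (simp_all add: unit_natural_image)
qed (simp_all add: counit_nat triangle_left triangle_right_image adj_simps unit_natural_image)

sublocale H: comonad D "F \<circ>\<^sub>F R" "\<lambda>d. ar F (\<eta> (ob R d))" \<sigma>
  by (rule adjunction_comonad)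

lemma comparison_functor: "is_functor C (adj_comodule_cat D F R \<eta> \<sigma>) (comparison C F \<eta>)"
proof -
  note [simp] = adj_simps
  have ob: "is_comodule D (F \<circ>\<^sub>F R) (\<lambda>d. ar F (\<eta> (ob R d))) \<sigma> (ob F c, ar F (\<eta> c))"
    if "c \<in> Obj C" for c
    using that by (simp add: H.is_comodule_iff triangle_left unit_natural_image)
  show ?thesis
    by (rule functorI) (simp_all add: C.category_axioms adj_comodule_cat_def comparison_def Let_def
        H.comodule_cat_simps Hom_iff ob H.comodule_hom_iff unit_natural_image)
qed

end

section \<open>A comonad morphism out of the comonad of an adjunction\<close>

locale adjunction_comonad_morphism = adjunction C D F R \<eta> \<sigma> + G: comonad D G \<delta> \<epsilon>
  for C :: "('o, 'a) cat" and D :: "('p, 'b) cat" and F R \<eta> \<sigma> G \<delta> \<epsilon> +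
  fixes t
  assumes morphism: "comonad_morphism D (F \<circ>\<^sub>F R) (\<lambda>d. ar F (\<eta> (ob R d))) \<sigma> G \<delta> \<epsilon> t"
begin

sublocale comonad_pair D "F \<circ>\<^sub>F R" "\<lambda>d. ar F (\<eta> (ob R d))" \<sigma> G \<delta> \<epsilon> t
  by unfold_locales (rule morphism)

lemma comparison_simps:
  "ob (push_fun D t) (ob (comparison C F \<eta>) c) = (ob F c, t (ob F c) \<cdot>\<^bsub>D\<^esub> ar F (\<eta> c))"
  "ar (push_fun D t) (ar (comparison C F \<eta>) f) =
     (ob (push_fun D t) (ob (comparison C F \<eta>) (Dom C f)), ar F f,
      ob (push_fun D t) (ob (comparison C F \<eta>) (Cod C f)))"
  by (simp_all add: comparison_def push_fun_simps Let_def)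

lemma cofree_comodule:
  assumes "d \<in> Obj D"
  shows "is_comodule D G \<delta> \<epsilon> (ob G d, \<delta> d)"
  using assms by (simp add: G.is_comodule_iff pair_simps G.counit_left G.comult_coassoc)

text \<open>This is the uniqueness half of the universal property of the cofree comodule. A comodule
  morphism \<open>k\<close> into it satisfies \<open>k = G (\<epsilon> d) \<cdot> \<delta> d \<cdot>
  k = G (\<epsilon> d \<cdot> k) \<cdot> \<theta>\<close>, so it is recovered from
  \<open>\<epsilon> d \<cdot> k\<close>.\<close>

lemma comodule_hom_cofree_eqI:
  assumes d: "d \<in> Obj D" and f: "f \<in> comodule_hom D G X (ob G d, \<delta> d)"
    and h: "h \<in> comodule_hom D G X (ob G d, \<delta> d)"
    and X: "is_comodule D G \<delta> \<epsilon> X"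
    and eq: "\<epsilon> d \<cdot>\<^bsub>D\<^esub> f = \<epsilon> d \<cdot>\<^bsub>D\<^esub> h"
  shows "f = h"
proof -
  note [simp] = pair_simps
  obtain x \<theta> where Xeq: "X = (x, \<theta>)"
    by (cases X)
  have \<theta>: "x \<in> Obj D" "\<theta> \<in> Arr D" "Dom D \<theta> = x" "Cod D \<theta> = ob G x"
    using X by (simp_all add: Xeq G.is_comodule_iff)
  have *: "k = ar G (\<epsilon> d \<cdot>\<^bsub>D\<^esub> k) \<cdot>\<^bsub>D\<^esub> \<theta>" if "k \<in> comodule_hom D G X (ob G d, \<delta> d)" for k
  proof -
    have k: "k \<in> Arr D" "Dom D k = x" "Cod D k = ob G d" "\<delta> d \<cdot>\<^bsub>D\<^esub> k = ar G k \<cdot>\<^bsub>D\<^esub> \<theta>"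
      using that by (simp_all add: Xeq G.comodule_hom_iff)
    have "k = ar G (\<epsilon> d) \<cdot>\<^bsub>D\<^esub> \<delta> d \<cdot>\<^bsub>D\<^esub> k"
      using d k(1-3) by (simp add: D.comp_extend[OF G.counit_right])
    also have "\<dots> = ar G (\<epsilon> d \<cdot>\<^bsub>D\<^esub> k) \<cdot>\<^bsub>D\<^esub> \<theta>"
      using d k \<theta> by simp
    finally show ?thesis .
  qed
  show ?thesis
    using *[OF f] *[OF h] eq by simp
qed

text \<open>The coaction of the source is \<open>t \<cdot> F \<eta>\<close> at
  \<open>ob R d\<close>, so the condition on a comodule morphism is exactly the comultiplication law
  \<open>t_comult\<close>.\<close>

lemma component_comodule_hom:
  assumes d: "d \<in> Obj D"
  shows "t d \<in> comodule_hom D G (ob (push_fun D t \<circ>\<^sub>F comparison C F \<eta>) (ob R d)) (ob G d, \<delta> d)"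
  using d t_comult[OF d]
  by (simp add: comparison_simps G.comodule_hom_iff pair_simps adj_simps)

text \<open>
  Let \<open>p\<close> be an isomorphism from the image of some object \<open>b\<close> to the cofree comodule on \<open>d\<close>.
  By fullness the comodule morphism \<open>t d\<close> is \<open>p \<cdot> F v\<close> for some \<open>v\<close>, and the transpose
  \<open>R (\<epsilon> d \<cdot> p) \<cdot> \<eta> b\<close> is inverse to \<open>v\<close>.
\<close>

lemma iso_if_equivalence:
  assumes eqv: "is_equivalence C (comodule_cat D G \<delta> \<epsilon>) (push_fun D t \<circ>\<^sub>F comparison C F \<eta>)"
    and d: "d \<in> Obj D"
  shows "is_iso D (t d)"
proof -
  note [simp] = pair_simps adj_simps G.comodule_cat_simps
  let ?K = "push_fun D t \<circ>\<^sub>F comparison C F \<eta>"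
  let ?E = "comodule_cat D G \<delta> \<epsilon>"
  interpret E: category ?E
    by (rule G.category_comodule_cat)
  obtain Q where Q: "is_functor ?E C Q" and K: "is_functor C ?E ?K"
    and KQ: "naturally_isomorphic ?E ?E (?K \<circ>\<^sub>F Q) id_fun"
    using eqv unfolding is_equivalence_def by blast
  obtain \<tau> where \<tau>: "is_nat_trans ?E ?E (?K \<circ>\<^sub>F Q) id_fun \<tau>"
    and \<tau>_iso: "\<And>X. X \<in> Obj ?E \<Longrightarrow> is_iso ?E (\<tau> X)"
    using KQ by (auto simp: naturally_isomorphic_def)
  let ?X = "(ob G d, \<delta> d)"
  have X: "?X \<in> Obj ?E"
    using cofree_comodule[OF d] by simp
  \<comment> \<open>The object \<open>b\<close> comes from essential surjectivity: the component of
    \<tau> at the cofree comodule is an isomorphism from \<open>ob ?K b\<close> to it, and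
    \<open>p\<close> is its underlying arrow.\<close>
  define b where "b = ob Q ?X"
  have b: "b \<in> Obj C"
    using X by (simp add: b_def functor_ob[OF Q])
  have Kob: "is_comodule D G \<delta> \<epsilon> (ob ?K c)" if "c \<in> Obj C" for c
    using functor_ob[OF K that] by simp
  obtain p where p\<tau>: "\<tau> ?X = (ob ?K b, p, ?X)"
    using nat_trans_ob(2,3)[OF \<tau> X] by (cases "\<tau> ?X") (simp add: b_def)
  obtain P where P: "P \<in> Arr ?E" "Dom ?E P = ?X" "Cod ?E P = ob ?K b"
    "P \<cdot>\<^bsub>?E\<^esub> \<tau> ?X = Ident ?E (ob ?K b)" "\<tau> ?X \<cdot>\<^bsub>?E\<^esub> P = Ident ?E ?X"
    using \<tau>_iso[OF X] by (elim E.isoE) (simp add: p\<tau>)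
  obtain p' where P_eq: "P = (?X, p', ob ?K b)"
    using P(2,3) by (cases P) simp
  have p_hom: "p \<in> comodule_hom D G (ob ?K b) ?X"
    using nat_trans_ob(1)[OF \<tau> X] by (simp add: p\<tau>)
  have p'_hom: "p' \<in> comodule_hom D G ?X (ob ?K b)"
    using P(1) by (simp add: P_eq)
  have p: "p \<in> Arr D" "Dom D p = ob F b" "Cod D p = ob G d"
    using p_hom by (simp_all add: comparison_simps(1) G.comodule_hom_iff)
  have p': "p' \<in> Arr D" "Dom D p' = ob G d" "Cod D p' = ob F b"
    using p'_hom by (simp_all add: comparison_simps(1) G.comodule_hom_iff)
  have p'p: "p' \<cdot>\<^bsub>D\<^esub> p = Ident D (ob F b)" and pp': "p \<cdot>\<^bsub>D\<^esub> p' = Ident D (ob G d)"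
    using P(4,5) by (simp_all add: p\<tau> P_eq comparison_simps(1))
  have p_iso: "is_iso D p"
    using p p' p'p pp' by (intro D.isoI[of p "ob F b" "ob G d" p']) (simp_all add: Hom_iff)
  let ?Y = "ob ?K (ob R d)"
  have t_arr: "(?Y, t d, ?X) \<in> Arr ?E"
    using component_comodule_hom[OF d] Kob[of "ob R d"] cofree_comodule[OF d] d by simp
  \<comment> \<open>Fullness concerns arrows between objects in the image of \<open>?K\<close>, so
    \<open>t d\<close> is first composed with the inverse of the isomorphism.\<close>
  have Pt: "P \<cdot>\<^bsub>?E\<^esub> (?Y, t d, ?X) \<in> Hom ?E ?Y (ob ?K b)"
    using t_arr P(1-3) by (intro E.comp_hom[of _ _ ?X]) (simp_all add: Hom_iff)
  obtain v where v: "v \<in> Hom C (ob R d) b" and Kv: "ar ?K v = P \<cdot>\<^bsub>?E\<^esub> (?Y, t d, ?X)"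
    by (rule equivalence_full[OF C.category_axioms E.category_axioms eqv _ b Pt]) (simp add: d)
  have v: "v \<in> Arr C" "Dom C v = ob R d" "Cod C v = b"
    using v by (simp_all add: Hom_iff)
  have Fv: "ar F v = p' \<cdot>\<^bsub>D\<^esub> t d"
    using Kv by (simp add: comparison_simps P_eq)
  have t_eq: "t d = p \<cdot>\<^bsub>D\<^esub> ar F v"
    using p p' d by (simp add: Fv D.comp_extend[OF pp'])
  \<comment> \<open>\<open>q\<close> corresponds to \<open>p\<close> under the universal property of
    the cofree comodule, and \<open>u\<close> is the transpose of \<open>q\<close> under the
    adjunction.\<close>
  define q where "q = \<epsilon> d \<cdot>\<^bsub>D\<^esub> p"
  have q: "q \<in> Arr D" "Dom D q = ob F b" "Cod D q = d"
    using p d by (simp_all add: q_def)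
  define u where "u = ar R q \<cdot>\<^bsub>C\<^esub> \<eta> b"
  have u: "u \<in> Arr C" "Dom C u = b" "Cod C u = ob R d"
    using q b by (simp_all add: u_def)
  \<comment> \<open>Since \<open>t d = p \<cdot> F v\<close>, this is the counit law of
    \<open>t\<close>. It makes \<open>u\<close> a left inverse of \<open>v\<close> by the right
    triangle identity.\<close>
  have qv: "q \<cdot>\<^bsub>D\<^esub> ar F v = \<sigma> d"
    using t_counit[OF d] p v d by (simp add: q_def t_eq)
  have "u \<cdot>\<^bsub>C\<^esub> v = ar R q \<cdot>\<^bsub>C\<^esub> ar R (ar F v) \<cdot>\<^bsub>C\<^esub> \<eta> (ob R d)"
    using q b v by (simp add: u_def unit_natural)
  also have "\<dots> = ar R (q \<cdot>\<^bsub>D\<^esub> ar F v) \<cdot>\<^bsub>C\<^esub> \<eta> (ob R d)"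
    using q b v d by simp
  finally have uv: "u \<cdot>\<^bsub>C\<^esub> v = Ident C (ob R d)"
    using d by (simp only: qv triangle_right)
  have Fu: "\<sigma> d \<cdot>\<^bsub>D\<^esub> ar F u = q"
  proof -
    have "\<sigma> d \<cdot>\<^bsub>D\<^esub> ar F u = (\<sigma> d \<cdot>\<^bsub>D\<^esub> ar F (ar R q)) \<cdot>\<^bsub>D\<^esub> ar F (\<eta> b)"
      using q b d by (simp add: u_def)
    also have "\<dots> = (q \<cdot>\<^bsub>D\<^esub> \<sigma> (ob F b)) \<cdot>\<^bsub>D\<^esub> ar F (\<eta> b)"
      using q by (simp only: counit_natural)
    finally show ?thesis
      using q b by (simp add: triangle_left)
  qed
  have "ar ?K u \<in> Arr ?E"
    using C.functor_ar(1)[OF K] u by simp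
  then have "(?Y, t d, ?X) \<cdot>\<^bsub>?E\<^esub> ar ?K u \<in> Hom ?E (ob ?K b) ?X"
    using t_arr u C.functor_ar(2,3)[OF K, of u] by (intro E.comp_hom[of _ _ ?Y]) (simp_all add: Hom_iff)
  then have tu_hom: "t d \<cdot>\<^bsub>D\<^esub> ar F u \<in> comodule_hom D G (ob ?K b) ?X"
    using u by (simp add: Hom_iff comparison_simps)
  have "\<epsilon> d \<cdot>\<^bsub>D\<^esub> t d \<cdot>\<^bsub>D\<^esub> ar F u = \<sigma> d \<cdot>\<^bsub>D\<^esub> ar F u"
    using u d by (intro D.comp_extend[OF t_counit]) simp_all
  \<comment> \<open>Both sides are comodule morphisms into the cofree comodule, and both have
    composite \<open>q\<close> with \<open>\<epsilon> d\<close>.\<close>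
  then have "t d \<cdot>\<^bsub>D\<^esub> ar F u = p"
    using Fu by (intro comodule_hom_cofree_eqI[OF d tu_hom p_hom Kob[OF b]]) (simp add: q_def)
  then have "p \<cdot>\<^bsub>D\<^esub> (ar F v \<cdot>\<^bsub>D\<^esub> ar F u) = p \<cdot>\<^bsub>D\<^esub> Ident D (ob F b)"
    using p u v by (simp add: t_eq)
  \<comment> \<open>The composite of \<open>v\<close> after \<open>u\<close> is computed only after
    applying \<open>F\<close>. This suffices, because \<open>t d = p \<cdot> F v\<close> is a
    factorization in \<open>D\<close>.\<close>
  then have vu: "ar F v \<cdot>\<^bsub>D\<^esub> ar F u = Ident D (ob F b)"
    by (rule D.iso_mono[OF p_iso, rotated 4]) (use p u v b in simp_all)
  have uv': "ar F u \<cdot>\<^bsub>D\<^esub> ar F v = Ident D (ob F (ob R d))"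
    using uv u v d functor_comp[OF left_functor, of v u] by simp
  have "is_iso D (ar F v)"
    using u v vu uv' d b
    by (intro D.isoI[of _ "ob F (ob R d)" "ob F b" "ar F u"]) (simp_all add: Hom_iff)
  then show ?thesis
    unfolding t_eq using p v by (intro D.iso_comp p_iso) simp_all
qed

theorem equivalence_iff_comonadic:
  "is_equivalence C (comodule_cat D G \<delta> \<epsilon>) (push_fun D t \<circ>\<^sub>F comparison C F \<eta>) \<longleftrightarrow>
    is_comonadic C D F R \<eta> \<sigma> \<and> (\<forall>d \<in> Obj D. is_iso D (t d))"
  using push_equivalence_iff[OF _ C.category_axioms comparison_functor[unfolded adj_comodule_cat_def]]
    iso_if_equivalence adj
  unfolding is_comonadic_def adj_comodule_cat_def by blast

end

section \<open>Modules over a monad\<close>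

text \<open>In calculations the images of the two sides of a square appear already split by
  functoriality. The split form can be substituted directly into a chain.\<close>

lemma (in category) functor_square:
  assumes "is_functor C D F" and "h \<cdot> f = k \<cdot> l"
    and "f \<in> Arr C" "h \<in> Arr C" "k \<in> Arr C" "l \<in> Arr C" "Dom C h = Cod C f" "Dom C k = Cod C l"
  shows "ar F h \<cdot>\<^bsub>D\<^esub> ar F f = ar F k \<cdot>\<^bsub>D\<^esub> ar F l"
  using assms functor_comp[OF assms(1)] by metis

context monad
begin

lemma module_cat_simps:
  "Obj (module_cat C T m e) = {X. is_module C T m e X}"
  "(X, f, Y) \<in> Arr (module_cat C T m e) \<longleftrightarrow>
     is_module C T m e X \<and> is_module C T m e Y \<and> f \<in> module_hom C T X Y"
  "Dom (module_cat C T m e) (X, f, Y) = X"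
  "Cod (module_cat C T m e) (X, f, Y) = Y"
  "Ident (module_cat C T m e) X = (X, Ident C (fst X), X)"
  "(Y', h, Z) \<cdot>\<^bsub>module_cat C T m e\<^esub> (X, f, Y) = (X, h \<cdot> f, Z)"
  by (simp_all add: module_cat_def)

lemma is_module_iff:
  "is_module C T m e (a, h) \<longleftrightarrow> a \<in> Obj C \<and> h \<in> Arr C \<and> Dom C h = ob T a \<and> Cod C h = a \<and>
     h \<cdot> e a = Ident C a \<and> h \<cdot> m a = h \<cdot> ar T h"
  by (auto simp: is_module_def Hom_iff)

lemma module_hom_iff:
  "f \<in> module_hom C T (a, h) (b, k) \<longleftrightarrow>
     f \<in> Arr C \<and> Dom C f = a \<and> Cod C f = b \<and> f \<cdot> h = k \<cdot> ar T f"
  by (auto simp: module_hom_def Hom_iff)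

lemmas monad_simps = functor_simps[OF monad_functor] nat_trans_ob[OF mult_nat, simplified]
  nat_trans_ob[OF unit_nat, simplified]

lemmas mult_natural = nat_trans_nat[OF mult_nat, simplified]
lemmas unit_natural = nat_trans_nat[OF unit_nat, simplified]

lemma module_hom_iff_fst_snd:
  "f \<in> module_hom C T X Y \<longleftrightarrow>
     f \<in> Arr C \<and> Dom C f = fst X \<and> Cod C f = fst Y \<and> f \<cdot> snd X = snd Y \<cdot> ar T f"
  by (cases X; cases Y) (simp add: module_hom_iff)

lemma module_hom_comp:
  assumes "is_module C T m e X" "is_module C T m e Y" "is_module C T m e Z"
    and "f \<in> module_hom C T X Y" "k \<in> module_hom C T Y Z"
  shows "k \<cdot> f \<in> module_hom C T X Z"
proof -
  note [simp] = cat_simps monad_simps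
  obtain a h b i c j where eq: "X = (a, h)" "Y = (b, i)" "Z = (c, j)"
    by (metis surj_pair)
  have f: "f \<in> Arr C" "Dom C f = a" "Cod C f = b" "f \<cdot> h = i \<cdot> ar T f"
    and k: "k \<in> Arr C" "Dom C k = b" "Cod C k = c" "k \<cdot> i = j \<cdot> ar T k"
    and h: "h \<in> Arr C" "Dom C h = ob T a" "Cod C h = a"
    and i: "i \<in> Arr C" "Dom C i = ob T b" "Cod C i = b"
    and j: "j \<in> Arr C" "Dom C j = ob T c" "Cod C j = c"
    using assms by (simp_all add: eq module_hom_iff is_module_iff)
  have "(k \<cdot> f) \<cdot> h = (k \<cdot> i) \<cdot> ar T f"
    using f k(1-3) h i by simp
  also have "\<dots> = j \<cdot> ar T (k \<cdot> f)"
    unfolding k(4) using f(1-3) k(1-3) j by simp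
  finally show ?thesis
    using f k by (simp add: eq module_hom_iff)
qed

lemma category_module_cat: "category (module_cat C T m e)"
proof
  let ?M = "module_cat C T m e"
  note [simp] = module_cat_simps cat_simps monad_simps Hom_iff
  {
    fix f assume "f \<in> Arr ?M"
    then show "Dom ?M f \<in> Obj ?M" "Cod ?M f \<in> Obj ?M"
      by (cases f; simp)+
  next
    fix X assume "X \<in> Obj ?M"
    then show "Ident ?M X \<in> Hom ?M X X"
      by (cases X) (simp add: is_module_iff module_hom_iff)
  next
    fix f h X Y Z assume "f \<in> Hom ?M X Y" "h \<in> Hom ?M Y Z"
    moreover obtain f' h' where "f = (X, f', Y)" "h = (Y, h', Z)"
      using calculation by (cases f; cases h) simp
    ultimately show "h \<cdot>\<^bsub>?M\<^esub> f \<in> Hom ?M X Z"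
      by (auto intro: module_hom_comp)
  next
    fix f X Y assume "f \<in> Hom ?M X Y"
    moreover obtain f' where "f = (X, f', Y)"
      using calculation by (cases f) simp
    ultimately show "Ident ?M Y \<cdot>\<^bsub>?M\<^esub> f = f" "f \<cdot>\<^bsub>?M\<^esub> Ident ?M X = f"
      by (simp_all add: module_hom_iff_fst_snd)
  next
    fix f h k W X Y Z assume "f \<in> Hom ?M W X" "h \<in> Hom ?M X Y" "k \<in> Hom ?M Y Z"
    moreover obtain f' h' k' where "f = (W, f', X)" "h = (X, h', Y)" "k = (Y, k', Z)"
      using calculation by (cases f; cases h; cases k) simp
    ultimately show "(k \<cdot>\<^bsub>?M\<^esub> h) \<cdot>\<^bsub>?M\<^esub> f = k \<cdot>\<^bsub>?M\<^esub> (h \<cdot>\<^bsub>?M\<^esub> f)"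
      by (simp add: module_hom_iff_fst_snd)
  }
qed

text \<open>An inverse \<open>p\<close> of the underlying arrow is automatically a module morphism:
  inserting \<open>T f \<cdot> T p = 1\<close> after \<open>k\<close> gives \<open>p \<cdot> k = p
  \<cdot> f \<cdot> h \<cdot> T p = h \<cdot> T p\<close>.\<close>

lemma module_iso_iff:
  assumes "(X, f, Y) \<in> Arr (module_cat C T m e)"
  shows "is_iso (module_cat C T m e) (X, f, Y) \<longleftrightarrow> is_iso C f"
proof
  let ?M = "module_cat C T m e"
  interpret M: category ?M
    by (rule category_module_cat)
  note [simp] = module_cat_simps cat_simps monad_simps
  have X: "is_module C T m e X" and Y: "is_module C T m e Y" and f: "f \<in> module_hom C T X Y"
    using assms by simp_all
  {
    assume "is_iso ?M (X, f, Y)"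
    then obtain P where P: "P \<in> Arr ?M" "Dom ?M P = Y" "Cod ?M P = X"
      "P \<cdot>\<^bsub>?M\<^esub> (X, f, Y) = Ident ?M X" "(X, f, Y) \<cdot>\<^bsub>?M\<^esub> P = Ident ?M Y"
      by (elim M.isoE) simp
    moreover obtain p where "P = (Y, p, X)"
      using P(2,3) by (cases P) simp
    ultimately show "is_iso C f"
      using f by (intro isoI[of f "fst X" "fst Y" p]) (simp_all add: Hom_iff module_hom_iff_fst_snd)
  next
    assume "is_iso C f"
    then obtain p where p: "p \<in> Arr C" "Dom C p = fst Y" "Cod C p = fst X"
      "p \<cdot> f = Ident C (fst X)" "f \<cdot> p = Ident C (fst Y)"
      using f by (elim isoE) (simp add: module_hom_iff_fst_snd)
    obtain a h b k where eq: "X = (a, h)" "Y = (b, k)"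
      by (metis surj_pair)
    have fhk: "f \<in> Arr C" "Dom C f = a" "Cod C f = b" "f \<cdot> h = k \<cdot> ar T f"
      "a \<in> Obj C" "b \<in> Obj C"
      "h \<in> Arr C" "Dom C h = ob T a" "Cod C h = a" "k \<in> Arr C" "Dom C k = ob T b" "Cod C k = b"
      using X Y f by (simp_all add: eq is_module_iff module_hom_iff)
    have Tfp: "ar T f \<cdot> ar T p = Ident C (ob T b)"
      using p fhk functor_comp[OF monad_functor, of p f] by (simp add: eq)
    have "p \<cdot> k = p \<cdot> k \<cdot> ar T f \<cdot> ar T p"
      unfolding Tfp using p fhk by (simp add: eq)
    also have "\<dots> = p \<cdot> (f \<cdot> h) \<cdot> ar T p"
      unfolding fhk(4) using p fhk(1-3,5-) by (simp add: eq)
    also have "\<dots> = h \<cdot> ar T p"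
      using p fhk(1-3,5-) by (simp add: eq comp_extend[OF p(4)])
    finally have "p \<in> module_hom C T Y X"
      using p by (simp add: eq module_hom_iff)
    then show "is_iso ?M (X, f, Y)"
      using X Y f p by (intro M.isoI[of _ X Y "(Y, p, X)"]) (simp_all add: Hom_iff)
  }
qed

section \<open>Free modules and the free/forgetful adjunction\<close>

lemma free_module: "a \<in> Obj C \<Longrightarrow> is_module C T m e (ob T a, m a)"
  by (simp add: is_module_iff cat_simps monad_simps unit_left mult_assoc)

lemma free_simps:
  "ob (free_fun C T m) a = (ob T a, m a)"
  "ar (free_fun C T m) f = ((ob T (Dom C f), m (Dom C f)), ar T f, (ob T (Cod C f), m (Cod C f)))"
  "ob forget_fun X = fst X"
  "ar forget_fun (X, f, Y) = f"
  "free_counit T m X = ((ob T (fst X), m (fst X)), snd X, X)"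
  by (simp_all add: free_fun_def forget_fun_def free_counit_def Let_def split: prod.splits)

text \<open>The counit at \<open>(a, h)\<close> is \<open>h\<close>, a module morphism out of the
  free module by the associativity law of \<open>h\<close>; its naturality is the defining equation
  of module morphisms. One triangle identity is \<open>unit_right\<close>, the other is the unit law
  of \<open>h\<close>.\<close>

lemma free_adjunction:
  "is_adjunction C (module_cat C T m e) (free_fun C T m) forget_fun e (free_counit T m)"
proof -
  let ?M = "module_cat C T m e"
  note [simp] = module_cat_simps cat_simps monad_simps Hom_iff free_simps
  interpret M: category ?M
    by (rule category_module_cat)
  have "is_functor C ?M (free_fun C T m)"
    by (rule functorI) (simp_all add: category_axioms free_module module_hom_iff mult_natural)
  moreover have "is_functor ?M C forget_fun"
  proof (rule functorI[OF M.category_axioms])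
    fix X assume "X \<in> Obj ?M"
    then show "ob forget_fun X \<in> Obj C" "ar forget_fun (Ident ?M X) = Ident C (ob forget_fun X)"
      by (cases X; simp add: is_module_iff)+
  next
    fix f assume "f \<in> Arr ?M"
    then show "ar forget_fun f \<in> Hom C (ob forget_fun (Dom ?M f)) (ob forget_fun (Cod ?M f))"
      by (cases f rule: prod_cases3) (simp add: module_hom_iff_fst_snd)
  next
    fix f h
    show "ar forget_fun (h \<cdot>\<^bsub>?M\<^esub> f) = ar forget_fun h \<cdot> ar forget_fun f"
      by (cases f rule: prod_cases3; cases h rule: prod_cases3) simp
  qed
  moreover have "is_nat_trans C C id_fun (forget_fun \<circ>\<^sub>F free_fun C T m) e"
    by (rule nat_transI) (simp_all add: unit_natural)
  moreover have "is_nat_trans ?M ?M (free_fun C T m \<circ>\<^sub>F forget_fun) id_fun (free_counit T m)"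
  proof (rule nat_transI)
    fix X assume "X \<in> Obj ?M"
    then show "free_counit T m X \<in> Hom ?M (ob (free_fun C T m \<circ>\<^sub>F forget_fun) X) (ob id_fun X)"
      by (cases X) (simp add: module_hom_iff is_module_iff unit_left mult_assoc)
  next
    fix f assume f: "f \<in> Arr ?M"
    obtain a h b k f' where "f = ((a, h), f', (b, k))"
      by (metis surj_pair)
    then show "free_counit T m (Cod ?M f) \<cdot>\<^bsub>?M\<^esub> ar (free_fun C T m \<circ>\<^sub>F forget_fun) f
        = ar id_fun f \<cdot>\<^bsub>?M\<^esub> free_counit T m (Dom ?M f)"
      using f by (simp add: module_hom_iff)
  qed
  moreover have "free_counit T m (ob (free_fun C T m) c) \<cdot>\<^bsub>?M\<^esub> ar (free_fun C T m) (e c)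
      = Ident ?M (ob (free_fun C T m) c)" if "c \<in> Obj C" for c
    using that by (simp add: unit_right)
  moreover have "ar forget_fun (free_counit T m d) \<cdot> e (ob forget_fun d) = Ident C (ob forget_fun d)"
    if "d \<in> Obj ?M" for d
    using that by (cases d) (simp add: is_module_iff)
  ultimately show ?thesis
    unfolding is_adjunction_def by blast
qed

end

section \<open>The lifted comonad and the comonad morphism of a grouplike morphism\<close>

context entwining
begin

lemmas entw_simps = cat_simps monad_simps comonad_simps nat_trans_ob[OF entw_nat, simplified]

lemmas entw_natural = nat_trans_nat[OF entw_nat, simplified]

lemma lift_simps:
  "lift_ob C G \<Lambda> (a, h) = (ob G a, ar G h \<cdot> \<Lambda> a)"
  "ob (lift_fun C G \<Lambda>) X = lift_ob C G \<Lambda> X"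
  "ar (lift_fun C G \<Lambda>) (X, f, Y) = (lift_ob C G \<Lambda> X, ar G f, lift_ob C G \<Lambda> Y)"
  "fst (lift_ob C G \<Lambda> X) = ob G (fst X)"
  by (simp_all add: lift_ob_def lift_fun_def split: prod.splits)

text \<open>\<open>entw_unit\<close> reduces the unit law to that of \<open>h\<close>, while
  \<open>entw_mult\<close> and naturality of \<Lambda> at \<open>h\<close> reduce associativity to
  that of \<open>h\<close>.\<close>

lemma lift_module:
  assumes "is_module C T m e X"
  shows "is_module C T m e (lift_ob C G \<Lambda> X)"
proof -
  note [simp] = entw_simps
  obtain a h where X: "X = (a, h)"
    by (cases X)
  have h: "a \<in> Obj C" "h \<in> Arr C" "Dom C h = ob T a" "Cod C h = a"
    and unit: "h \<cdot> e a = Ident C a" and assoc: "h \<cdot> m a = h \<cdot> ar T h"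
    using assms by (simp_all add: X is_module_iff)
  have "(ar G h \<cdot> \<Lambda> a) \<cdot> e (ob G a) = ar G (h \<cdot> e a)"
    using h by (simp add: entw_unit)
  then have 1: "(ar G h \<cdot> \<Lambda> a) \<cdot> e (ob G a) = Ident C (ob G a)"
    using h by (simp add: unit)
  have "(ar G h \<cdot> \<Lambda> a) \<cdot> m (ob G a) = (ar G h \<cdot> ar G (m a)) \<cdot> \<Lambda> (ob T a) \<cdot> ar T (\<Lambda> a)"
    using h by (simp add: entw_mult)
  also have "ar G h \<cdot> ar G (m a) = ar G h \<cdot> ar G (ar T h)"
    using h by (intro functor_square[OF comonad_functor assoc]) simp_all
  also have "(ar G h \<cdot> ar G (ar T h)) \<cdot> \<Lambda> (ob T a) \<cdot> ar T (\<Lambda> a)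
      = ar G h \<cdot> (ar G (ar T h) \<cdot> \<Lambda> (ob T a)) \<cdot> ar T (\<Lambda> a)"
    using h by simp
  also have "\<dots> = ar G h \<cdot> (\<Lambda> a \<cdot> ar T (ar G h)) \<cdot> ar T (\<Lambda> a)"
    using h by (simp only: entw_natural)
  also have "\<dots> = (ar G h \<cdot> \<Lambda> a) \<cdot> ar T (ar G h \<cdot> \<Lambda> a)"
    using h by simp
  finally show ?thesis
    using h 1 by (simp add: X lift_simps is_module_iff)
qed

lemma lift_module_hom:
  assumes "is_module C T m e X" "is_module C T m e Y" "f \<in> module_hom C T X Y"
  shows "ar G f \<in> module_hom C T (lift_ob C G \<Lambda> X) (lift_ob C G \<Lambda> Y)"
proof -
  note [simp] = entw_simps
  obtain a h b k where eq: "X = (a, h)" "Y = (b, k)"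
    by (metis surj_pair)
  have f: "f \<in> Arr C" "Dom C f = a" "Cod C f = b"
    and ab: "a \<in> Obj C" "b \<in> Obj C" "h \<in> Arr C" "Dom C h = ob T a" "Cod C h = a"
      "k \<in> Arr C" "Dom C k = ob T b" "Cod C k = b" and fh: "f \<cdot> h = k \<cdot> ar T f"
    using assms by (simp_all add: eq is_module_iff module_hom_iff)
  have "ar G f \<cdot> ar G h \<cdot> \<Lambda> a = (ar G k \<cdot> ar G (ar T f)) \<cdot> \<Lambda> a"
    using f ab by (intro comp_extend functor_square[OF comonad_functor fh]) simp_all
  also have "\<dots> = ar G k \<cdot> (ar G (ar T f) \<cdot> \<Lambda> a)"
    using f ab by simp
  also have "\<dots> = ar G k \<cdot> (\<Lambda> b \<cdot> ar T (ar G f))"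
    using f ab by (simp only: entw_natural)
  finally show ?thesis
    using f ab by (simp add: eq module_hom_iff lift_simps)
qed

text \<open>Naturality carries \<delta> past \<open>G h\<close>, and \<open>entw_comult\<close> then
  carries it past the \<Lambda> in the lifted structure arrow.\<close>

lemma lift_comult_hom:
  assumes "is_module C T m e X"
  shows "\<delta> (fst X) \<in> module_hom C T (lift_ob C G \<Lambda> X) (lift_ob C G \<Lambda> (lift_ob C G \<Lambda> X))"
proof -
  note [simp] = entw_simps
  obtain a h where X: "X = (a, h)"
    by (cases X)
  have h: "a \<in> Obj C" "h \<in> Arr C" "Dom C h = ob T a" "Cod C h = a"
    using assms by (simp_all add: X is_module_iff)
  have "\<delta> a \<cdot> ar G h \<cdot> \<Lambda> a = (ar G (ar G h) \<cdot> \<delta> (ob T a)) \<cdot> \<Lambda> a"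
    using h by (intro comp_extend) (simp_all add: nat_trans_nat[OF comult_nat, simplified])
  also have "\<dots> = ar G (ar G h) \<cdot> ar G (\<Lambda> a) \<cdot> \<Lambda> (ob G a) \<cdot> ar T (\<delta> a)"
    using h by (simp add: entw_comult)
  finally show ?thesis
    using h by (simp add: X module_hom_iff lift_simps)
qed

lemma lift_counit_hom:
  assumes "is_module C T m e X"
  shows "\<epsilon> (fst X) \<in> module_hom C T (lift_ob C G \<Lambda> X) X"
proof -
  note [simp] = entw_simps
  obtain a h where X: "X = (a, h)"
    by (cases X)
  have h: "a \<in> Obj C" "h \<in> Arr C" "Dom C h = ob T a" "Cod C h = a"
    using assms by (simp_all add: X is_module_iff)
  have "\<epsilon> a \<cdot> ar G h \<cdot> \<Lambda> a = (h \<cdot> \<epsilon> (ob T a)) \<cdot> \<Lambda> a"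
    using h by (intro comp_extend) (simp_all add: nat_trans_nat[OF counit_nat, simplified])
  also have "\<dots> = h \<cdot> ar T (\<epsilon> a)"
    using h by (simp add: entw_counit)
  finally show ?thesis
    using h by (simp add: X module_hom_iff lift_simps)
qed

lemma module_fst_obj: "is_module C T m e X \<Longrightarrow> fst X \<in> Obj C"
  by (cases X) (simp add: is_module_iff)

text \<open>Module arrows compose as their underlying arrows do, so functoriality, naturality and
  the comonad laws are inherited from \<open>G\<close>. The properties of \<Lambda> enter through
  the preceding lemmas, which show that the lifted data consist of modules and module
  morphisms.\<close>

lemma lifted_comonad:
  "comonad (module_cat C T m e) (lift_fun C G \<Lambda>) (lift_comult C G \<delta> \<Lambda>) (lift_counit C G \<epsilon> \<Lambda>)"
proof -
  let ?M = "module_cat C T m e" and ?L = "lift_fun C G \<Lambda>"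
  interpret M: category ?M
    by (rule category_module_cat)
  note [simp] = module_cat_simps lift_simps(2-4) entw_simps Hom_iff lift_module lift_module_hom
    lift_comult_hom lift_counit_hom lift_comult_def lift_counit_def module_fst_obj
  show ?thesis
  proof
    show "is_functor ?M ?M ?L"
    proof (rule functorI[OF M.category_axioms])
      fix f assume "f \<in> Arr ?M"
      then show "ar ?L f \<in> Hom ?M (ob ?L (Dom ?M f)) (ob ?L (Cod ?M f))"
        by (cases f rule: prod_cases3) simp
    next
      fix f h assume "f \<in> Arr ?M" "h \<in> Arr ?M" "Dom ?M h = Cod ?M f"
      then show "ar ?L (h \<cdot>\<^bsub>?M\<^esub> f) = ar ?L h \<cdot>\<^bsub>?M\<^esub> ar ?L f"
        by (cases f rule: prod_cases3; cases h rule: prod_cases3)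
          (simp add: module_hom_iff_fst_snd functor_comp[OF comonad_functor])
    qed simp_all
    show "is_nat_trans ?M ?M ?L (?L \<circ>\<^sub>F ?L) (lift_comult C G \<delta> \<Lambda>)"
    proof (rule nat_transI)
      fix f assume "f \<in> Arr ?M"
      then show "lift_comult C G \<delta> \<Lambda> (Cod ?M f) \<cdot>\<^bsub>?M\<^esub> ar ?L f
          = ar (?L \<circ>\<^sub>F ?L) f \<cdot>\<^bsub>?M\<^esub> lift_comult C G \<delta> \<Lambda> (Dom ?M f)"
        by (cases f rule: prod_cases3)
          (simp add: module_hom_iff_fst_snd nat_trans_nat[OF comult_nat, simplified])
    qed simp
    show "is_nat_trans ?M ?M ?L id_fun (lift_counit C G \<epsilon> \<Lambda>)"
    proof (rule nat_transI)
      fix f assume "f \<in> Arr ?M"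
      then show "lift_counit C G \<epsilon> \<Lambda> (Cod ?M f) \<cdot>\<^bsub>?M\<^esub> ar ?L f
          = ar id_fun f \<cdot>\<^bsub>?M\<^esub> lift_counit C G \<epsilon> \<Lambda> (Dom ?M f)"
        by (cases f rule: prod_cases3)
          (simp add: module_hom_iff_fst_snd nat_trans_nat[OF counit_nat, simplified])
    qed simp
  qed (simp_all add: comult_coassoc counit_left counit_right)
qed

end

section \<open>The comonad morphism induced by a grouplike morphism\<close>

locale entwining_grouplike = entwining C T m e G \<delta> \<epsilon> \<Lambda> + grouplike C G \<delta> \<epsilon> g
  for C :: "('o, 'a) cat" (structure) and T m e G \<delta> \<epsilon> \<Lambda> g
begin

lemmas eg_simps = entw_simps nat_trans_ob[OF grouplike_nat, simplified]

lemmas grouplike_natural = nat_trans_nat[OF grouplike_nat, simplified]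

text \<open>This is the composite of condition (ii). On a module it is the transpose of
  \<open>g a\<close> under the free/forgetful adjunction, because
  \<open>ar G h \<cdot> \<Lambda> a\<close> is the structure arrow of the lifted module.\<close>

definition grouplike_arr :: "('o, 'a) module_obj \<Rightarrow> 'a" where
  "grouplike_arr = (\<lambda>(a, h). ar G h \<cdot> \<Lambda> a \<cdot> ar T (g a))"

text \<open>The triple turns the composite into an arrow of the module category, from the comonad of
  the free/forgetful adjunction at \<open>X\<close> to the lifted comonad at
  \<open>X\<close>.\<close>

definition grouplike_trans :: "('o, 'a) module_obj \<Rightarrow> ('o, 'a) module_arr" where
  "grouplike_trans X = ((ob T (fst X), m (fst X)), grouplike_arr X, lift_ob C G \<Lambda> X)"

lemma grouplike_arr_simp: "grouplike_arr (a, h) = ar G h \<cdot> \<Lambda> a \<cdot> ar T (g a)"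
  by (simp add: grouplike_arr_def)

text \<open>Naturality of \<open>m\<close> at \<open>g a\<close> trades \<open>m a\<close> for
  \<open>m (ob G a)\<close>, which \<open>entw_mult\<close> expands; associativity of
  \<open>h\<close> and naturality of \<Lambda> then reassemble \<open>T\<close> of the whole
  composite.\<close>

lemma grouplike_arr_hom:
  assumes "is_module C T m e (a, h)"
  shows "grouplike_arr (a, h) \<in> module_hom C T (ob T a, m a) (lift_ob C G \<Lambda> (a, h))"
proof -
  note [simp] = eg_simps
  have h: "a \<in> Obj C" "h \<in> Arr C" "Dom C h = ob T a" "Cod C h = a"
    and assoc: "h \<cdot> m a = h \<cdot> ar T h"
    using assms by (simp_all add: is_module_iff)
  have "grouplike_arr (a, h) \<cdot> m a = ar G h \<cdot> \<Lambda> a \<cdot> m (ob G a) \<cdot> ar T (ar T (g a))"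
    using h by (simp add: grouplike_arr_simp mult_natural)
  also have "\<dots> = ar G h \<cdot> (ar G (m a) \<cdot> \<Lambda> (ob T a) \<cdot> ar T (\<Lambda> a)) \<cdot> ar T (ar T (g a))"
    using h by (subst comp_extend[OF entw_mult]) simp_all
  also have "\<dots> = (ar G h \<cdot> ar G (m a)) \<cdot> \<Lambda> (ob T a) \<cdot> ar T (\<Lambda> a) \<cdot> ar T (ar T (g a))"
    using h by simp
  also have "ar G h \<cdot> ar G (m a) = ar G h \<cdot> ar G (ar T h)"
    using h by (intro functor_square[OF comonad_functor assoc]) simp_all
  also have "(ar G h \<cdot> ar G (ar T h)) \<cdot> \<Lambda> (ob T a) \<cdot> ar T (\<Lambda> a) \<cdot> ar T (ar T (g a))
      = ar G h \<cdot> (ar G (ar T h) \<cdot> \<Lambda> (ob T a)) \<cdot> ar T (\<Lambda> a) \<cdot> ar T (ar T (g a))"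
    using h by simp
  also have "\<dots> = ar G h \<cdot> (\<Lambda> a \<cdot> ar T (ar G h)) \<cdot> ar T (\<Lambda> a) \<cdot> ar T (ar T (g a))"
    using h by (simp only: entw_natural)
  also have "\<dots> = (ar G h \<cdot> \<Lambda> a) \<cdot> ar T (grouplike_arr (a, h))"
    using h by (simp add: grouplike_arr_simp)
  finally show ?thesis
    using h by (simp add: grouplike_arr_simp lift_simps module_hom_iff)
qed

lemma grouplike_trans_hom:
  assumes "is_module C T m e X"
  shows "grouplike_trans X \<in> Arr (module_cat C T m e)"
  using assms grouplike_arr_hom[of "fst X" "snd X"]
  by (simp add: grouplike_trans_def module_cat_simps lift_module free_module module_fst_obj)

text \<open>\<open>f\<close> is moved leftwards through the three factors by naturality of
  \<open>g\<close>, naturality of \<Lambda>, and the image under \<open>G\<close> of its equation as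
  a module morphism.\<close>

lemma grouplike_arr_natural:
  assumes "is_module C T m e (a, h)" "is_module C T m e (b, k)" "f \<in> module_hom C T (a, h) (b, k)"
  shows "grouplike_arr (b, k) \<cdot> ar T f = ar G f \<cdot> grouplike_arr (a, h)"
proof -
  note [simp] = eg_simps
  have f: "f \<in> Arr C" "Dom C f = a" "Cod C f = b"
    and ab: "a \<in> Obj C" "b \<in> Obj C" "h \<in> Arr C" "Dom C h = ob T a" "Cod C h = a"
      "k \<in> Arr C" "Dom C k = ob T b" "Cod C k = b" and fh: "f \<cdot> h = k \<cdot> ar T f"
    using assms by (simp_all add: is_module_iff module_hom_iff)
  have "grouplike_arr (b, k) \<cdot> ar T f = ar G k \<cdot> \<Lambda> b \<cdot> ar T (g b) \<cdot> ar T f"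
    using f ab by (simp add: grouplike_arr_simp)
  also have "ar T (g b) \<cdot> ar T f = ar T (ar G f) \<cdot> ar T (g a)"
    using f ab by (intro functor_square[OF monad_functor grouplike_natural]) simp_all
  also have "ar G k \<cdot> \<Lambda> b \<cdot> ar T (ar G f) \<cdot> ar T (g a)
      = ar G k \<cdot> (\<Lambda> b \<cdot> ar T (ar G f)) \<cdot> ar T (g a)"
    using f ab by simp
  also have "\<dots> = ar G k \<cdot> (ar G (ar T f) \<cdot> \<Lambda> a) \<cdot> ar T (g a)"
    using f ab by (simp only: entw_natural)
  also have "\<dots> = (ar G k \<cdot> ar G (ar T f)) \<cdot> \<Lambda> a \<cdot> ar T (g a)"
    using f ab by simp
  also have "ar G k \<cdot> ar G (ar T f) = ar G f \<cdot> ar G h"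
    using f ab by (intro functor_square[OF comonad_functor fh[symmetric]]) simp_all
  finally show ?thesis
    using f ab by (simp add: grouplike_arr_simp)
qed

text \<open>Pushing the comparison comodule of \<open>a\<close> along \<open>grouplike_trans\<close>
  produces the left side as coaction, while the right side is the coaction used by
  \<open>K_ob\<close>. Naturality of \<open>g\<close> and \<Lambda> at \<open>e a\<close> moves the
  unit leftwards until \<open>unit_right\<close> absorbs it.\<close>

lemma grouplike_arr_free:
  assumes "a \<in> Obj C"
  shows "grouplike_arr (ob T a, m a) \<cdot> ar T (e a) = \<Lambda> a \<cdot> ar T (g a)"
proof -
  note [simp] = eg_simps
  have "grouplike_arr (ob T a, m a) \<cdot> ar T (e a)
      = ar G (m a) \<cdot> \<Lambda> (ob T a) \<cdot> ar T (g (ob T a)) \<cdot> ar T (e a)"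
    using assms by (simp add: grouplike_arr_simp)
  also have "ar T (g (ob T a)) \<cdot> ar T (e a) = ar T (ar G (e a)) \<cdot> ar T (g a)"
    using assms by (intro functor_square[OF monad_functor grouplike_natural]) simp_all
  also have "ar G (m a) \<cdot> \<Lambda> (ob T a) \<cdot> ar T (ar G (e a)) \<cdot> ar T (g a)
      = ar G (m a) \<cdot> (\<Lambda> (ob T a) \<cdot> ar T (ar G (e a))) \<cdot> ar T (g a)"
    using assms by simp
  also have "\<dots> = ar G (m a) \<cdot> (ar G (ar T (e a)) \<cdot> \<Lambda> a) \<cdot> ar T (g a)"
    using assms by (simp add: entw_natural)
  also have "\<dots> = ar G (m a \<cdot> ar T (e a)) \<cdot> \<Lambda> a \<cdot> ar T (g a)"
    using assms by simp
  finally show ?thesis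
    using assms by (simp add: unit_right)
qed

text \<open>Naturality at \<open>h\<close> and \<open>entw_counit\<close> bring \<epsilon> to
  \<open>g a\<close> under \<open>T\<close>, where the counit law of the grouplike morphism cancels
  the two.\<close>

lemma grouplike_arr_counit:
  assumes "is_module C T m e (a, h)"
  shows "\<epsilon> a \<cdot> grouplike_arr (a, h) = h"
proof -
  note [simp] = eg_simps
  have h: "a \<in> Obj C" "h \<in> Arr C" "Dom C h = ob T a" "Cod C h = a"
    using assms by (simp_all add: is_module_iff)
  have "\<epsilon> a \<cdot> grouplike_arr (a, h) = (h \<cdot> \<epsilon> (ob T a)) \<cdot> \<Lambda> a \<cdot> ar T (g a)"
    unfolding grouplike_arr_simp using h
    by (intro comp_extend) (simp_all add: nat_trans_nat[OF counit_nat, simplified])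
  also have "\<dots> = h \<cdot> ar T (\<epsilon> a) \<cdot> ar T (g a)"
    using h by (simp add: comp_extend[OF entw_counit])
  also have "ar T (\<epsilon> a) \<cdot> ar T (g a) = ar T (\<epsilon> a \<cdot> g a)"
    using h by simp
  finally show ?thesis
    using h by (simp add: grouplike_counit)
qed

text \<open>The key inputs are \<open>entw_comult\<close> and \<open>grouplike_comult\<close>. The
  tail \<open>\<Lambda> a \<cdot> ar T (g a)\<close> is kept because
  \<open>grouplike_arr_free\<close> identifies it with the component at the free module composed
  with \<open>T (e a)\<close>, which gives the comultiplication law of a comonad morphism.\<close>

lemma grouplike_arr_comult:
  assumes "is_module C T m e (a, h)"
  shows "\<delta> a \<cdot> grouplike_arr (a, h) = ar G (grouplike_arr (a, h)) \<cdot> \<Lambda> a \<cdot> ar T (g a)"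
proof -
  note [simp] = eg_simps
  have h: "a \<in> Obj C" "h \<in> Arr C" "Dom C h = ob T a" "Cod C h = a"
    using assms by (simp_all add: is_module_iff)
  have "\<delta> a \<cdot> grouplike_arr (a, h) = (ar G (ar G h) \<cdot> \<delta> (ob T a)) \<cdot> \<Lambda> a \<cdot> ar T (g a)"
    unfolding grouplike_arr_simp using h
    by (intro comp_extend) (simp_all add: nat_trans_nat[OF comult_nat, simplified])
  also have "\<dots> = ar G (ar G h) \<cdot> ar G (\<Lambda> a) \<cdot> \<Lambda> (ob G a) \<cdot> ar T (\<delta> a) \<cdot> ar T (g a)"
    using h by (simp add: comp_extend[OF entw_comult])
  also have "ar T (\<delta> a) \<cdot> ar T (g a) = ar T (ar G (g a)) \<cdot> ar T (g a)"
    using h by (intro functor_square[OF monad_functor grouplike_comult]) simp_all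
  also have "ar G (ar G h) \<cdot> ar G (\<Lambda> a) \<cdot> \<Lambda> (ob G a) \<cdot> ar T (ar G (g a)) \<cdot> ar T (g a)
      = ar G (ar G h) \<cdot> ar G (\<Lambda> a) \<cdot> (\<Lambda> (ob G a) \<cdot> ar T (ar G (g a))) \<cdot> ar T (g a)"
    using h by simp
  also have "\<dots> = ar G (ar G h) \<cdot> ar G (\<Lambda> a) \<cdot> (ar G (ar T (g a)) \<cdot> \<Lambda> a) \<cdot> ar T (g a)"
    using h by (simp add: entw_natural)
  finally show ?thesis
    using h by (simp add: grouplike_arr_simp)
qed

lemma grouplike_comonad_morphism:
  "comonad_morphism (module_cat C T m e) (free_fun C T m \<circ>\<^sub>F forget_fun)
     (\<lambda>X. ar (free_fun C T m) (e (ob forget_fun X))) (free_counit T m)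
     (lift_fun C G \<Lambda>) (lift_comult C G \<delta> \<Lambda>) (lift_counit C G \<epsilon> \<Lambda>) grouplike_trans"
proof -
  let ?M = "module_cat C T m e"
  note [simp] = module_cat_simps lift_simps free_simps eg_simps Hom_iff grouplike_trans_def
    lift_comult_def lift_counit_def
  have "is_nat_trans ?M ?M (free_fun C T m \<circ>\<^sub>F forget_fun) (lift_fun C G \<Lambda>) grouplike_trans"
  proof (rule nat_transI)
    fix X assume "X \<in> Obj ?M"
    then show "grouplike_trans X \<in>
        Hom ?M (ob (free_fun C T m \<circ>\<^sub>F forget_fun) X) (ob (lift_fun C G \<Lambda>) X)"
      using grouplike_trans_hom[of X] by simp
  next
    fix f assume f: "f \<in> Arr ?M"
    obtain a h b k f' where eq: "f = ((a, h), f', (b, k))"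
      by (metis surj_pair)
    show "grouplike_trans (Cod ?M f) \<cdot>\<^bsub>?M\<^esub> ar (free_fun C T m \<circ>\<^sub>F forget_fun) f
        = ar (lift_fun C G \<Lambda>) f \<cdot>\<^bsub>?M\<^esub> grouplike_trans (Dom ?M f)"
      using f grouplike_arr_natural[of a h b k f'] by (simp add: eq module_hom_iff_fst_snd)
  qed
  moreover have "lift_counit C G \<epsilon> \<Lambda> X \<cdot>\<^bsub>?M\<^esub> grouplike_trans X = free_counit T m X"
    if "X \<in> Obj ?M" for X
    using that by (cases X) (simp add: grouplike_arr_counit)
  moreover have "lift_comult C G \<delta> \<Lambda> X \<cdot>\<^bsub>?M\<^esub> grouplike_trans X =
      ar (lift_fun C G \<Lambda>) (grouplike_trans X) \<cdot>\<^bsub>?M\<^esub>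
      (grouplike_trans (ob (free_fun C T m \<circ>\<^sub>F forget_fun) X) \<cdot>\<^bsub>?M\<^esub>
        ar (free_fun C T m) (e (ob forget_fun X)))"
    if "X \<in> Obj ?M" for X
    using that by (cases X) (simp add: grouplike_arr_comult grouplike_arr_free module_fst_obj is_module_iff)
  ultimately show ?thesis
    unfolding comonad_morphism_def by blast
qed

sublocale adjunction_comonad_morphism C "module_cat C T m e" "free_fun C T m" forget_fun e
  "free_counit T m" "lift_fun C G \<Lambda>" "lift_comult C G \<delta> \<Lambda>" "lift_counit C G \<epsilon> \<Lambda>" grouplike_trans
  by (intro adjunction_comonad_morphism.intro adjunction.intro adjunction_axioms.intro
      adjunction_comonad_morphism_axioms.intro category_axioms category_module_cat
      free_adjunction lifted_comonad grouplike_comonad_morphism)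

text \<open>The coactions coincide by \<open>grouplike_arr_free\<close>. Since the equalities are
  claimed on the carriers only, \<open>is_equivalence_cong\<close> is what later transfers the
  equivalence.\<close>

lemma K_fun_eq:
  shows "a \<in> Obj C \<Longrightarrow> ob (K_fun C T m G \<Lambda> g) a =
      ob (push_fun (module_cat C T m e) grouplike_trans \<circ>\<^sub>F comparison C (free_fun C T m) e) a"
    and "f \<in> Arr C \<Longrightarrow> ar (K_fun C T m G \<Lambda> g) f =
      ar (push_fun (module_cat C T m e) grouplike_trans \<circ>\<^sub>F comparison C (free_fun C T m) e) f"
  by (simp_all add: K_fun_def K_ob_def Let_def comparison_simps free_simps module_cat_simps
      grouplike_trans_def grouplike_arr_free monad_simps cat_simps)

theorem K_fun_equivalence_iff:
  "is_equivalence C (entwined_cat C T m e G \<delta> \<epsilon> \<Lambda>) (K_fun C T m G \<Lambda> g) \<longleftrightarrow>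
    is_comonadic C (module_cat C T m e) (free_fun C T m) forget_fun e (free_counit T m) \<and>
    (\<forall>(a, h) \<in> Obj (module_cat C T m e). is_iso C (ar G h \<cdot> \<Lambda> a \<cdot> ar T (g a)))"
proof -
  let ?M = "module_cat C T m e"
  \<comment> \<open>Invertibility of the module arrow is compared with that of its underlying arrow,
    which turns the condition on \<open>grouplike_trans\<close> into condition (ii).\<close>
  have iso: "is_iso ?M (grouplike_trans (a, h)) \<longleftrightarrow> is_iso C (ar G h \<cdot> \<Lambda> a \<cdot> ar T (g a))"
    if "is_module C T m e (a, h)" for a h
    using module_iso_iff grouplike_trans_hom[OF that]
    by (simp add: grouplike_trans_def grouplike_arr_simp)
  have "is_equivalence C (entwined_cat C T m e G \<delta> \<epsilon> \<Lambda>) (K_fun C T m G \<Lambda> g) \<longleftrightarrow>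
      is_equivalence C (entwined_cat C T m e G \<delta> \<epsilon> \<Lambda>)
        (push_fun ?M grouplike_trans \<circ>\<^sub>F comparison C (free_fun C T m) e)"
    unfolding entwined_cat_def
    by (rule is_equivalence_cong[OF category_axioms G.category_comodule_cat])
      (simp_all only: K_fun_eq)
  also have "\<dots> \<longleftrightarrow> is_comonadic C ?M (free_fun C T m) forget_fun e (free_counit T m) \<and>
      (\<forall>X \<in> Obj ?M. is_iso ?M (grouplike_trans X))"
    unfolding entwined_cat_def by (rule equivalence_iff_comonadic)
  also have "(\<forall>X \<in> Obj ?M. is_iso ?M (grouplike_trans X)) \<longleftrightarrow>
      (\<forall>(a, h) \<in> Obj ?M. is_iso C (ar G h \<cdot> \<Lambda> a \<cdot> ar T (g a)))"
    using iso by (auto simp: module_cat_simps)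
  finally show ?thesis .
qed

end

theorem theorem4p1:
  fixes A :: "('o, 'a) cat"
    and T G :: "('o, 'a, 'o, 'a) functor_data"
    and m e \<delta> \<epsilon> \<Lambda> g :: "'o \<Rightarrow> 'a"
  assumes "monad A T m e"
    and "comonad A G \<delta> \<epsilon>"
    and "entwining A T m e G \<delta> \<epsilon> \<Lambda>"
    and "grouplike A G \<delta> \<epsilon> g"
  shows "is_equivalence A (entwined_cat A T m e G \<delta> \<epsilon> \<Lambda>) (K_fun A T m G \<Lambda> g) \<longleftrightarrow>
    is_comonadic A (module_cat A T m e) (free_fun A T m) forget_fun e (free_counit T m) \<and>
    (\<forall>(a, h) \<in> Obj (module_cat A T m e). is_iso A (ar G h \<cdot>\<^bsub>A\<^esub> \<Lambda> a \<cdot>\<^bsub>A\<^esub> ar T (g a)))"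
  by (rule entwining_grouplike.K_fun_equivalence_iff[OF entwining_grouplike.intro[OF assms(3,4)]])

end
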